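(* Let $k,n,m\ge 1$. Every map $f:R^n\to R^m$ is an i-morphism for the respective $k$th-order i-structures, i.e. for every $p\in\mathbb{N}$ and every $(P_1,\dots,P_p)\in (R^n)_k\langle p\rangle$ one has $(f(P_1),\dots,f(P_p))\in (R^m)_k\langle p\rangle$.
   Context: Setting: naive axiomatic Synthetic Differential Geometry, i.e. one argues intuitionistically (in the internal logic of a topos); "space" means a set/object of this universe and "map" an arbitrary map. $R$ is a commutative ring which is a $\mathbb{Q}$-algebra. For $k,n\ge 1$ let $D_k(n)=\{(d_1,\dots,d_n)\in R^n \mid \text{any product of } k+1 \text{ of the } d_j \text{ (repetitions allowed) vanishes}\}$. $R$ is assumed to satisfy the Kock–Lawvere axiom for all $D_k(n)$, $k,n\ge1$: every map $t:D_k(n)\to R$ is given by a uniquely determined polynomial in $R[X_1,\dots,X_n]$ of total degree $\le k$. An i-structure on a space $A$ is a family of subsets $A\langle p\rangle\subseteq A^p$ ($p\in\mathbb{N}$) such that (1) $A\langle 1\rangle=A$, $A\langle 0\rangle=A^0=1$; (2) for every map $h:\{1,\dots,m\}\to\{1,\dots,p\}$ and every $(P_1,\dots,P_p)\in A\langle p\rangle$ one has $(P_{h(1)},\dots,P_{h(m)})\in A\langle m\rangle$. A map $f:A\to X$ between spaces with i-structures is an i-morphism if $f^p(A\langle p\rangle)\subseteq X\langle p\rangle$ for all $p$. For $V=R^n$ put $\mathrm{DN}_k(V)=\{(v_1,\dots,v_{k+1})\in D_k(n)^{k+1}\mid \phi(v_1,\dots,v_{k+1})=0 \text{ for every } (k+1)\text{-linear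 map } \phi:V^{k+1}\to R\}$. The $k$th-order i-structure $A_k$ on $A=R^n$ is: $A_k\langle 1\rangle=A$, $A_k\langle 0\rangle=A^0=1$, and for $p\ge 2$, $A_k\langle p\rangle=\{(P_1,\dots,P_p)\in A^p\mid (P_{i_1}-P_{j_1},\dots,P_{i_{k+1}}-P_{j_{k+1}})\in \mathrm{DN}_k(V) \text{ for all } i_\ell,j_\ell\in\{1,\dots,p\},\ i_\ell\ne j_\ell,\ 1\le \ell\le k+1\}$. *)

theory Defs
  imports Complex_Main "HOL-Algebra.Ring" "HOL-Library.FuncSet"
begin

text \<open>
  Over classical logic the Kock--Lawvere axiom holds only in the zero ring, so the universe of
  Synthetic Differential Geometry cannot be the universe of HOL sets.  Here it is an arbitrary
  elementary topos, and statements of its internal logic are rendered by their Kripke--Joyal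
  semantics: an element of a space \<open>X\<close> at stage \<open>U\<close> is an arrow \<open>U \<rightarrow> X\<close>, passing to a later
  stage along \<open>h : W \<rightarrow> U\<close> is composition with \<open>h\<close>, and an internal universal quantifier or
  implication at stage \<open>U\<close> ranges over all later stages.
\<close>


section \<open>Elementary toposes\<close>

record ('o, 'a) topos_data =
  Obj :: "'o set"
  Arr :: "'a set"
  Dom :: "'a \<Rightarrow> 'o"
  Cod :: "'a \<Rightarrow> 'o"
  Id :: "'o \<Rightarrow> 'a"
  Comp :: "'a \<Rightarrow> 'a \<Rightarrow> 'a"
  One :: "'o"
  Prod :: "'o \<Rightarrow> 'o \<Rightarrow> 'o"
  Fst :: "'o \<Rightarrow> 'o \<Rightarrow> 'a"
  Snd :: "'o \<Rightarrow> 'o \<Rightarrow> 'a"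
  Exp :: "'o \<Rightarrow> 'o \<Rightarrow> 'o"  \<comment> \<open>\<open>Exp E X Y\<close> is the space of maps from \<open>X\<close> to \<open>Y\<close>\<close>
  Ev :: "'o \<Rightarrow> 'o \<Rightarrow> 'a"
  Omega :: "'o"
  Tru :: "'a"

definition Hom :: "('o, 'a) topos_data \<Rightarrow> 'o \<Rightarrow> 'o \<Rightarrow> 'a set" where
  "Hom E X Y = {f \<in> Arr E. Dom E f = X \<and> Cod E f = Y}"

definition bang :: "('o, 'a) topos_data \<Rightarrow> 'o \<Rightarrow> 'a" where
  "bang E U = (THE f. f \<in> Hom E U (One E))"

definition pair :: "('o, 'a) topos_data \<Rightarrow> 'a \<Rightarrow> 'a \<Rightarrow> 'a" where
  "pair E f g = (THE h. h \<in> Hom E (Dom E f) (Prod E (Cod E f) (Cod E g)) \<and>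
     Comp E (Fst E (Cod E f) (Cod E g)) h = f \<and> Comp E (Snd E (Cod E f) (Cod E g)) h = g)"

locale category =
  fixes E :: "('o, 'a) topos_data"
  assumes Dom_in_Obj: "f \<in> Arr E \<Longrightarrow> Dom E f \<in> Obj E"
    and Cod_in_Obj: "f \<in> Arr E \<Longrightarrow> Cod E f \<in> Obj E"
    and Id_in_hom: "X \<in> Obj E \<Longrightarrow> Id E X \<in> Hom E X X"
    and Comp_in_hom: "f \<in> Hom E X Y \<Longrightarrow> g \<in> Hom E Y Z \<Longrightarrow> Comp E g f \<in> Hom E X Z"
    and Comp_Id_right: "f \<in> Hom E X Y \<Longrightarrow> Comp E f (Id E X) = f"
    and Comp_Id_left: "f \<in> Hom E X Y \<Longrightarrow> Comp E (Id E Y) f = f"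
    and Comp_assoc: "f \<in> Hom E X Y \<Longrightarrow> g \<in> Hom E Y Z \<Longrightarrow> h \<in> Hom E Z T \<Longrightarrow>
        Comp E h (Comp E g f) = Comp E (Comp E h g) f"

definition is_mono :: "('o, 'a) topos_data \<Rightarrow> 'a \<Rightarrow> bool" where
  "is_mono E m \<longleftrightarrow> m \<in> Arr E \<and>
     (\<forall>U \<in> Obj E. \<forall>x \<in> Hom E U (Dom E m). \<forall>y \<in> Hom E U (Dom E m).
        Comp E m x = Comp E m y \<longrightarrow> x = y)"

locale elementary_topos = category E for E :: "('o, 'a) topos_data" +
  assumes terminal: "One E \<in> Obj E" "U \<in> Obj E \<Longrightarrow> \<exists>!f. f \<in> Hom E U (One E)"
    and product:
      "X \<in> Obj E \<Longrightarrow> Y \<in> Obj E \<Longrightarrow> Prod E X Y \<in> Obj E"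
      "X \<in> Obj E \<Longrightarrow> Y \<in> Obj E \<Longrightarrow> Fst E X Y \<in> Hom E (Prod E X Y) X"
      "X \<in> Obj E \<Longrightarrow> Y \<in> Obj E \<Longrightarrow> Snd E X Y \<in> Hom E (Prod E X Y) Y"
      "f \<in> Hom E U X \<Longrightarrow> g \<in> Hom E U Y \<Longrightarrow>
        \<exists>!h. h \<in> Hom E U (Prod E X Y) \<and> Comp E (Fst E X Y) h = f \<and> Comp E (Snd E X Y) h = g"
    and equalizer:
      "f \<in> Hom E X Y \<Longrightarrow> g \<in> Hom E X Y \<Longrightarrow>
        \<exists>S \<in> Obj E. \<exists>e \<in> Hom E S X. Comp E f e = Comp E g e \<and>
          (\<forall>U \<in> Obj E. \<forall>x \<in> Hom E U X. Comp E f x = Comp E g x \<longrightarrow>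
             (\<exists>!y. y \<in> Hom E U S \<and> Comp E e y = x))"
    and exponential:
      "X \<in> Obj E \<Longrightarrow> Y \<in> Obj E \<Longrightarrow> Exp E X Y \<in> Obj E"
      "X \<in> Obj E \<Longrightarrow> Y \<in> Obj E \<Longrightarrow> Ev E X Y \<in> Hom E (Prod E (Exp E X Y) X) Y"
      "U \<in> Obj E \<Longrightarrow> X \<in> Obj E \<Longrightarrow> Y \<in> Obj E \<Longrightarrow> f \<in> Hom E (Prod E U X) Y \<Longrightarrow>
        \<exists>!g. g \<in> Hom E U (Exp E X Y) \<and>
          Comp E (Ev E X Y) (pair E (Comp E g (Fst E U X)) (Snd E U X)) = f"
    and subobject_classifier:
      "Omega E \<in> Obj E" "Tru E \<in> Hom E (One E) (Omega E)"
      "m \<in> Hom E S X \<Longrightarrow> is_mono E m \<Longrightarrow>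
        \<exists>!c. c \<in> Hom E X (Omega E) \<and> Comp E c m = Comp E (Tru E) (bang E S) \<and>
          (\<forall>U \<in> Obj E. \<forall>x \<in> Hom E U X. Comp E c x = Comp E (Tru E) (bang E U) \<longrightarrow>
             (\<exists>!y. y \<in> Hom E U S \<and> Comp E m y = x))"

text \<open>The value \<open>f(x)\<close> at stage \<open>U\<close> of a map \<open>f : U \<rightarrow> Exp X Y\<close> at a point \<open>x : U \<rightarrow> X\<close>.\<close>

definition app :: "('o, 'a) topos_data \<Rightarrow> 'o \<Rightarrow> 'o \<Rightarrow> 'a \<Rightarrow> 'a \<Rightarrow> 'a" where
  "app E X Y f x = Comp E (Ev E X Y) (pair E f x)"

primrec pow :: "('o, 'a) topos_data \<Rightarrow> 'o \<Rightarrow> nat \<Rightarrow> 'o" where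
  "pow E X 0 = One E"
| "pow E X (Suc n) = Prod E (pow E X n) X"

text \<open>Components of points of \<open>X\<^sup>n\<close> are indexed by \<open>{..<n}\<close>.\<close>

primrec proj :: "('o, 'a) topos_data \<Rightarrow> 'o \<Rightarrow> nat \<Rightarrow> nat \<Rightarrow> 'a" where
  "proj E X 0 i = undefined"
| "proj E X (Suc n) i =
     (if i = n then Snd E (pow E X n) X
      else Comp E (proj E X n i) (Fst E (pow E X n) X))"

primrec tuple :: "('o, 'a) topos_data \<Rightarrow> 'o \<Rightarrow> nat \<Rightarrow> (nat \<Rightarrow> 'a) \<Rightarrow> 'a" where
  "tuple E U 0 x = bang E U"
| "tuple E U (Suc n) x = pair E (tuple E U n x) (x n)"

text \<open>
  \<open>S U\<close> is the set of elements at stage \<open>U\<close> of a subset of \<open>X\<close> described in the internal logic;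
  \<open>i : D \<rightarrow> X\<close> is the subobject which is the extent of that subset.
\<close>

definition is_extent ::
  "('o, 'a) topos_data \<Rightarrow> 'o \<Rightarrow> ('o \<Rightarrow> 'a set) \<Rightarrow> 'o \<Rightarrow> 'a \<Rightarrow> bool" where
  "is_extent E X S D i \<longleftrightarrow> i \<in> Hom E D X \<and> is_mono E i \<and>
     (\<forall>U \<in> Obj E. \<forall>x \<in> Hom E U X. x \<in> S U \<longleftrightarrow> (\<exists>d \<in> Hom E U D. x = Comp E i d))"


section \<open>The ring \<open>R\<close>\<close>

record ('o, 'a) ring_data =
  Space :: "'o"
  Add :: "'a"
  Mult :: "'a"
  Zero :: "'a"
  Unit :: "'a"

definition at_stage :: "('o, 'a) topos_data \<Rightarrow> ('o, 'a) ring_data \<Rightarrow> 'o \<Rightarrow> 'a ring" where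
  "at_stage E R U =
     \<lparr>carrier = Hom E U (Space R),
      monoid.mult = (\<lambda>x y. Comp E (Mult R) (pair E x y)),
      one = Comp E (Unit R) (bang E U),
      zero = Comp E (Zero R) (bang E U),
      add = (\<lambda>x y. Comp E (Add R) (pair E x y))\<rparr>"

definition rat_ring :: "rat ring" where
  "rat_ring = \<lparr>carrier = UNIV, monoid.mult = (*), one = 1, zero = 0, add = (+)\<rparr>"

text \<open>
  A \<open>\<rat>\<close>-algebra structure is a ring homomorphism from \<open>\<rat>\<close> to the ring of global elements of \<open>R\<close>;
  restriction along \<open>U \<rightarrow> 1\<close> makes the ring at every stage a \<open>\<rat>\<close>-algebra.
\<close>

locale comm_rat_algebra_object = elementary_topos E for E :: "('o, 'a) topos_data" +
  fixes R :: "('o, 'a) ring_data"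
  assumes Space_in_Obj: "Space R \<in> Obj E"
    and Add_in_hom: "Add R \<in> Hom E (Prod E (Space R) (Space R)) (Space R)"
    and Mult_in_hom: "Mult R \<in> Hom E (Prod E (Space R) (Space R)) (Space R)"
    and Zero_in_hom: "Zero R \<in> Hom E (One E) (Space R)"
    and Unit_in_hom: "Unit R \<in> Hom E (One E) (Space R)"
    and cring_at_stage: "U \<in> Obj E \<Longrightarrow> cring (at_stage E R U)"
    and rat_algebra: "\<exists>\<phi>. \<phi> \<in> ring_hom rat_ring (at_stage E R (One E))"

abbreviation Rpow :: "('o, 'a) topos_data \<Rightarrow> ('o, 'a) ring_data \<Rightarrow> nat \<Rightarrow> 'o" where
  "Rpow E R n \<equiv> pow E (Space R) n"

definition coord :: "('o, 'a) topos_data \<Rightarrow> ('o, 'a) ring_data \<Rightarrow> nat \<Rightarrow> nat \<Rightarrow> 'a \<Rightarrow> 'a" where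
  "coord E R n c v = Comp E (proj E (Space R) n c) v"

definition vadd ::
  "('o, 'a) topos_data \<Rightarrow> ('o, 'a) ring_data \<Rightarrow> nat \<Rightarrow> 'o \<Rightarrow> 'a \<Rightarrow> 'a \<Rightarrow> 'a" where
  "vadd E R n U v w = tuple E U n (\<lambda>c. coord E R n c v \<oplus>\<^bsub>at_stage E R U\<^esub> coord E R n c w)"

definition vdiff ::
  "('o, 'a) topos_data \<Rightarrow> ('o, 'a) ring_data \<Rightarrow> nat \<Rightarrow> 'o \<Rightarrow> 'a \<Rightarrow> 'a \<Rightarrow> 'a" where
  "vdiff E R n U v w = tuple E U n (\<lambda>c. coord E R n c v \<ominus>\<^bsub>at_stage E R U\<^esub> coord E R n c w)"

definition vscale ::
  "('o, 'a) topos_data \<Rightarrow> ('o, 'a) ring_data \<Rightarrow> nat \<Rightarrow> 'o \<Rightarrow> 'a \<Rightarrow> 'a \<Rightarrow> 'a" where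
  "vscale E R n U r v = tuple E U n (\<lambda>c. r \<otimes>\<^bsub>at_stage E R U\<^esub> coord E R n c v)"


section \<open>Infinitesimals and the Kock--Lawvere axiom\<close>

text \<open>\<open>Dk E R k n U\<close> is the set of elements of \<open>D\<^sub>k(n) \<subseteq> R\<^sup>n\<close> at stage \<open>U\<close>.\<close>

definition Dk ::
  "('o, 'a) topos_data \<Rightarrow> ('o, 'a) ring_data \<Rightarrow> nat \<Rightarrow> nat \<Rightarrow> 'o \<Rightarrow> 'a set" where
  "Dk E R k n U = {d \<in> Hom E U (Rpow E R n).
     \<forall>j \<in> {..<Suc k} \<rightarrow> {..<n}.
       (\<Otimes>\<^bsub>at_stage E R U\<^esub> l \<in> {..<Suc k}. coord E R n (j l) d) = \<zero>\<^bsub>at_stage E R U\<^esub>}"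

definition multi_indices :: "nat \<Rightarrow> nat \<Rightarrow> (nat \<Rightarrow> nat) set" where
  "multi_indices n k = {\<alpha>. (\<forall>c \<ge> n. \<alpha> c = 0) \<and> (\<Sum>c<n. \<alpha> c) \<le> k}"

text \<open>
  A polynomial in \<open>n\<close> variables of total degree at most \<open>k\<close> over a ring \<open>G\<close> is its family of
  coefficients \<open>a \<in> multi_indices n k \<rightarrow>\<^sub>E carrier G\<close>.
\<close>

definition poly_eval ::
  "('a, 'm) ring_scheme \<Rightarrow> nat \<Rightarrow> nat \<Rightarrow> ((nat \<Rightarrow> nat) \<Rightarrow> 'a) \<Rightarrow> (nat \<Rightarrow> 'a) \<Rightarrow> 'a" where
  "poly_eval G n k a x =
     (\<Oplus>\<^bsub>G\<^esub> \<alpha> \<in> multi_indices n k. a \<alpha> \<otimes>\<^bsub>G\<^esub> (\<Otimes>\<^bsub>G\<^esub> c \<in> {..<n}. x c [^]\<^bsub>G\<^esub> \<alpha> c))"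

definition kock_lawvere :: "('o, 'a) topos_data \<Rightarrow> ('o, 'a) ring_data \<Rightarrow> bool" where
  "kock_lawvere E R \<longleftrightarrow>
     (\<forall>k \<ge> 1. \<forall>n \<ge> 1. \<forall>D i. is_extent E (Rpow E R n) (Dk E R k n) D i \<longrightarrow>
       (\<forall>U \<in> Obj E. \<forall>t \<in> Hom E U (Exp E D (Space R)).
         \<exists>!a. a \<in> multi_indices n k \<rightarrow>\<^sub>E Hom E U (Space R) \<and>
           (\<forall>W \<in> Obj E. \<forall>h \<in> Hom E W U. \<forall>d \<in> Hom E W D.
              app E D (Space R) (Comp E t h) d =
              poly_eval (at_stage E R W) n k
                (\<lambda>\<alpha>. Comp E (a \<alpha>) h) (\<lambda>c. coord E R n c (Comp E i d)))))"


section \<open>Multilinear maps and the \<open>k\<close>th-order i-structure\<close>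

definition app_tuple ::
  "('o, 'a) topos_data \<Rightarrow> ('o, 'a) ring_data \<Rightarrow> nat \<Rightarrow> nat \<Rightarrow> 'o \<Rightarrow> 'a \<Rightarrow> (nat \<Rightarrow> 'a) \<Rightarrow> 'a" where
  "app_tuple E R n q U \<phi> v =
     app E (pow E (Rpow E R n) q) (Space R) \<phi> (tuple E U q v)"

text \<open>The map \<open>\<phi> : (R\<^sup>n)\<^sup>q \<rightarrow> R\<close>, given at stage \<open>U\<close>, is \<open>q\<close>-linear.\<close>

definition multilinear ::
  "('o, 'a) topos_data \<Rightarrow> ('o, 'a) ring_data \<Rightarrow> nat \<Rightarrow> nat \<Rightarrow> 'o \<Rightarrow> 'a \<Rightarrow> bool" where
  "multilinear E R n q U \<phi> \<longleftrightarrow>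
     \<phi> \<in> Hom E U (Exp E (pow E (Rpow E R n) q) (Space R)) \<and>
     (\<forall>W \<in> Obj E. \<forall>h \<in> Hom E W U. \<forall>v \<in> {..<q} \<rightarrow> Hom E W (Rpow E R n). \<forall>l < q.
        (\<forall>x \<in> Hom E W (Rpow E R n). \<forall>y \<in> Hom E W (Rpow E R n).
           app_tuple E R n q W (Comp E \<phi> h) (v(l := vadd E R n W x y)) =
           app_tuple E R n q W (Comp E \<phi> h) (v(l := x)) \<oplus>\<^bsub>at_stage E R W\<^esub>
           app_tuple E R n q W (Comp E \<phi> h) (v(l := y))) \<and>
        (\<forall>r \<in> Hom E W (Space R). \<forall>x \<in> Hom E W (Rpow E R n).
           app_tuple E R n q W (Comp E \<phi> h) (v(l := vscale E R n W r x)) =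
           r \<otimes>\<^bsub>at_stage E R W\<^esub> app_tuple E R n q W (Comp E \<phi> h) (v(l := x))))"

text \<open>The vectors \<open>v\<^sub>1, \<dots>, v\<^sub>k\<^sub>+\<^sub>1\<close> are indexed by \<open>{..<Suc k}\<close>.\<close>

definition DN ::
  "('o, 'a) topos_data \<Rightarrow> ('o, 'a) ring_data \<Rightarrow> nat \<Rightarrow> nat \<Rightarrow> 'o \<Rightarrow> (nat \<Rightarrow> 'a) set" where
  "DN E R k n U = {v. (\<forall>l < Suc k. v l \<in> Dk E R k n U) \<and>
     (\<forall>W \<in> Obj E. \<forall>h \<in> Hom E W U. \<forall>\<phi>. multilinear E R n (Suc k) W \<phi> \<longrightarrow>
        app_tuple E R n (Suc k) W \<phi> (\<lambda>l. Comp E (v l) h) = \<zero>\<^bsub>at_stage E R W\<^esub>)}"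

text \<open>
  A family of subsets \<open>A\<langle>p\<rangle> \<subseteq> A\<^sup>p\<close> is given by its elements at each stage \<open>U\<close>; a point of \<open>A\<^sup>p\<close> at
  stage \<open>U\<close> is written as a \<open>p\<close>-tuple of points of \<open>A\<close> at stage \<open>U\<close>.
\<close>

definition kth_order ::
  "('o, 'a) topos_data \<Rightarrow> ('o, 'a) ring_data \<Rightarrow> nat \<Rightarrow> nat \<Rightarrow> nat \<Rightarrow> 'o \<Rightarrow> (nat \<Rightarrow> 'a) set" where
  "kth_order E R k n p U = {P \<in> {..<p} \<rightarrow>\<^sub>E Hom E U (Rpow E R n).
     p \<ge> 2 \<longrightarrow>
       (\<forall>i \<in> {..<Suc k} \<rightarrow> {..<p}. \<forall>j \<in> {..<Suc k} \<rightarrow> {..<p}.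
          (\<forall>l < Suc k. i l \<noteq> j l) \<longrightarrow>
          (\<lambda>l. vdiff E R n U (P (i l)) (P (j l))) \<in> DN E R k n U)}"

definition i_morphism ::
  "('o, 'a) topos_data \<Rightarrow> 'o \<Rightarrow> (nat \<Rightarrow> 'o \<Rightarrow> (nat \<Rightarrow> 'a) set) \<Rightarrow>
    'o \<Rightarrow> (nat \<Rightarrow> 'o \<Rightarrow> (nat \<Rightarrow> 'a) set) \<Rightarrow> 'o \<Rightarrow> 'a \<Rightarrow> bool" where
  "i_morphism E A SA X SX U f \<longleftrightarrow> f \<in> Hom E U (Exp E A X) \<and>
     (\<forall>p. \<forall>W \<in> Obj E. \<forall>h \<in> Hom E W U. \<forall>P \<in> SA p W.
        (\<lambda>l \<in> {..<p}. app E A X (Comp E f h) (P l)) \<in> SX p W)"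

end

theory Submission
  imports Defs
begin

text \<open>
  Let \<open>w = f(P) - f(Q)\<close> where \<open>d = P - Q\<close> lies in \<open>D\<^sub>k(n)\<close>.  Each coordinate of \<open>f(Q + x)\<close> is, for \<open>x\<close>
  in \<open>D\<^sub>k(n)\<close>, a polynomial in \<open>x\<close> by the Kock--Lawvere axiom.  Taking its values at \<open>x = d\<close> and at
  \<open>x = 0\<close> shows that every coordinate of \<open>w\<close> lies in the ideal generated by the coordinates of \<open>d\<close>.
  Consequently a product of coordinates of \<open>w\<^sub>0, \<dots>, w\<^sub>k\<close>, one from each vector, is a combination of
  products of coordinates of \<open>d\<^sub>0, \<dots>, d\<^sub>k\<close>, again one from each, and it vanishes as soon as all of
  the latter do.

  The \<open>k\<close>th-order condition on vectors is exactly such a condition on products of coordinates: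
  a \<open>(k+1)\<close>-tuple of elements of \<open>D\<^sub>k(n)\<close> belongs to \<open>DN\<^sub>k\<close> if and only if all products of one
  coordinate from each vector vanish.  One direction (\<open>DN_coord_product_eq_zero\<close>) holds because these
  products are themselves \<open>(k+1)\<close>-linear maps, the other (\<open>coord_products_eq_zero_imp_DN\<close>) because
  every \<open>(k+1)\<close>-linear map is a combination of them.  Membership of a single \<open>w\<close> in \<open>D\<^sub>k(m)\<close> is the
  same statement about products with all vectors equal, so both halves of \<open>DN\<^sub>k\<close> are transported by
  one computation (\<open>map_preserves_DN\<close>).

  "Lies in the ideal generated by \<open>d\<^sub>0, \<dots>, d\<^sub>n\<^sub>-\<^sub>1\<close>" is replaced throughout by the weaker "is
  annihilated by every \<open>y\<close> that annihilates \<open>d\<^sub>0, \<dots>, d\<^sub>n\<^sub>-\<^sub>1\<close>".  This suffices for the vanishing of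
  products and avoids naming coefficients: instead of expanding a product or a multilinear map into a
  sum over all choices of indices, one moves its factors one after another into a multiplier \<open>r\<close>.

  The argument takes place in the internal logic, so points are arrows out of a stage \<open>W\<close>, and a map
  defined by a formula in a variable of \<open>X\<close> is obtained by evaluating the formula at the projections
  of \<open>W \<times> X\<close> and transposing (\<open>obtain_transpose\<close>).  The Kock--Lawvere axiom speaks of an object
  representing \<open>D\<^sub>k(n)\<close>, which finite limits provide (\<open>Dk_has_extent\<close>).
\<close>


section \<open>Annihilators in a commutative ring\<close>

context cring
begin

text \<open>
  Being equal after multiplication by a fixed \<open>y\<close> is congruence modulo the annihilator of \<open>y\<close>.  That
  is an ideal, so the congruence is respected by powers, products and sums, hence by polynomials.
\<close>

lemma mult_nat_pow_cong:
  assumes "y \<in> carrier R" "a \<in> carrier R" "b \<in> carrier R" and eq: "y \<otimes> a = y \<otimes> b"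
  shows "y \<otimes> a [^] (e :: nat) = y \<otimes> b [^] e"
proof (induction e)
  case 0
  show ?case by simp
next
  case (Suc e)
  have "y \<otimes> a [^] Suc e = (y \<otimes> a [^] e) \<otimes> a"
    using assms by (simp add: m_assoc)
  also have "\<dots> = (y \<otimes> a) \<otimes> b [^] e"
    unfolding Suc using assms(1-3) by (simp add: m_ac)
  also have "\<dots> = y \<otimes> b [^] Suc e"
    unfolding eq using assms(1-3) by (simp add: m_ac)
  finally show ?case .
qed

lemma mult_finprod_cong:
  assumes "y \<in> carrier R" "u \<in> A \<rightarrow> carrier R" "v \<in> A \<rightarrow> carrier R"
    and "\<And>c. c \<in> A \<Longrightarrow> y \<otimes> u c = y \<otimes> v c"
  shows "y \<otimes> finprod R u A = y \<otimes> finprod R v A"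
  using assms
proof (induction A rule: infinite_finite_induct)
  case (insert c A)
  have c: "u c \<in> carrier R" "v c \<in> carrier R" "finprod R u A \<in> carrier R" "finprod R v A \<in> carrier R"
    using insert.prems by auto
  have "y \<otimes> finprod R u (insert c A) = (y \<otimes> finprod R u A) \<otimes> u c"
    using insert.hyps insert.prems(1-3) c by (simp add: m_ac)
  also have "y \<otimes> finprod R u A = y \<otimes> finprod R v A"
    using insert by simp
  also have "(y \<otimes> finprod R v A) \<otimes> u c = (y \<otimes> u c) \<otimes> finprod R v A"
    using insert.prems(1) c by (simp add: m_ac)
  also have "y \<otimes> u c = y \<otimes> v c"
    using insert.prems(4) by simp
  also have "(y \<otimes> v c) \<otimes> finprod R v A = y \<otimes> finprod R v (insert c A)"
    using insert.hyps insert.prems(1-3) c by (simp add: m_ac)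
  finally show ?case .
qed simp_all

lemma mult_finsum_cong:
  assumes "y \<in> carrier R" "u \<in> A \<rightarrow> carrier R" "v \<in> A \<rightarrow> carrier R"
    and "\<And>c. c \<in> A \<Longrightarrow> y \<otimes> u c = y \<otimes> v c"
  shows "y \<otimes> finsum R u A = y \<otimes> finsum R v A"
  using assms
proof (induction A rule: infinite_finite_induct)
  case (insert c A)
  have "u c \<in> carrier R" "v c \<in> carrier R" "finsum R u A \<in> carrier R" "finsum R v A \<in> carrier R"
    using insert.prems by auto
  then show ?case
    using insert by (simp add: r_distr)
qed simp_all

lemma mult_poly_eval_cong:
  assumes y: "y \<in> carrier R" and a: "a \<in> multi_indices n k \<rightarrow> carrier R"
    and x: "x \<in> {..<n} \<rightarrow> carrier R" "x' \<in> {..<n} \<rightarrow> carrier R"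
    and eq: "\<And>c. c < n \<Longrightarrow> y \<otimes> x c = y \<otimes> x' c"
  shows "y \<otimes> poly_eval R n k a x = y \<otimes> poly_eval R n k a x'"
  unfolding poly_eval_def
proof (rule mult_finsum_cong)
  fix \<alpha> assume \<alpha>: "\<alpha> \<in> multi_indices n k"
  let ?m = "\<lambda>x. \<Otimes>c \<in> {..<n}. x c [^] \<alpha> c"
  have mc: "?m x \<in> carrier R" "?m x' \<in> carrier R"
    using x by (auto intro!: finprod_closed)
  have aa: "a \<alpha> \<in> carrier R"
    using a \<alpha> by auto
  have "y \<otimes> ?m x = y \<otimes> ?m x'"
    using y x eq by (intro mult_finprod_cong mult_nat_pow_cong) auto
  then show "y \<otimes> (a \<alpha> \<otimes> ?m x) = y \<otimes> (a \<alpha> \<otimes> ?m x')"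
    using m_lcomm[OF y aa mc(1)] m_lcomm[OF y aa mc(2)] by simp
next
  have "(\<lambda>\<alpha>. a \<alpha> \<otimes> (\<Otimes>c \<in> {..<n}. z c [^] \<alpha> c)) \<in> multi_indices n k \<rightarrow> carrier R"
    if "z \<in> {..<n} \<rightarrow> carrier R" for z
    by (intro funcsetI m_closed finprod_closed nat_pow_closed) (use a that in auto)
  then show "(\<lambda>\<alpha>. a \<alpha> \<otimes> (\<Otimes>c \<in> {..<n}. x c [^] \<alpha> c)) \<in> multi_indices n k \<rightarrow> carrier R"
    "(\<lambda>\<alpha>. a \<alpha> \<otimes> (\<Otimes>c \<in> {..<n}. x' c [^] \<alpha> c)) \<in> multi_indices n k \<rightarrow> carrier R"
    using x by blast+
qed (rule y)

text \<open>
  The hypothesis on \<open>w l\<close> is the annihilator form of membership in the ideal generated by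
  \<open>d l 0, \<dots>, d l (n - 1)\<close>.  The multiplier \<open>r\<close> makes the induction work: the last factor \<open>w s\<close> is
  absorbed into \<open>r\<close>, and for each choice \<open>j\<close> of the remaining indices the element
  \<open>y = r \<otimes> d 0 (j 0) \<otimes> \<dots>\<close> annihilates all \<open>d s c\<close>, hence \<open>w s\<close>.
\<close>

lemma mult_finprod_eq_zero:
  assumes "r \<in> carrier R"
    and "\<And>l c. l < s \<Longrightarrow> c < n \<Longrightarrow> d l c \<in> carrier R"
    and "\<And>l. l < s \<Longrightarrow> w l \<in> carrier R"
    and "\<And>l y. l < s \<Longrightarrow> y \<in> carrier R \<Longrightarrow> (\<And>c. c < n \<Longrightarrow> y \<otimes> d l c = \<zero>) \<Longrightarrow> y \<otimes> w l = \<zero>"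
    and "\<And>j. j \<in> {..<s} \<rightarrow> {..<n} \<Longrightarrow> r \<otimes> (\<Otimes>l \<in> {..<s}. d l (j l)) = \<zero>"
  shows "r \<otimes> (\<Otimes>l \<in> {..<s :: nat}. w l) = \<zero>"
  using assms
proof (induction s arbitrary: r)
  case 0
  then show ?case by simp
next
  case (Suc s)
  have ws: "w s \<in> carrier R" and w: "w \<in> {..<s} \<rightarrow> carrier R"
    using Suc.prems by auto
  have "(r \<otimes> w s) \<otimes> (\<Otimes>l \<in> {..<s}. w l) = \<zero>"
  proof (rule Suc.IH)
    fix j assume j: "j \<in> {..<s} \<rightarrow> {..<n}"
    have dj: "(\<lambda>l. d l (j l)) \<in> {..<s} \<rightarrow> carrier R"
      using j Suc.prems(2) by (auto simp: Pi_iff)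
    let ?y = "r \<otimes> (\<Otimes>l \<in> {..<s}. d l (j l))"
    have "?y \<otimes> w s = \<zero>"
    proof (rule Suc.prems(4))
      fix c assume c: "c < n"
      have "j(s := c) \<in> {..<Suc s} \<rightarrow> {..<n}"
        using j c by (auto simp: less_Suc_eq Pi_iff)
      then have "r \<otimes> (\<Otimes>l \<in> {..<Suc s}. d l ((j(s := c)) l)) = \<zero>"
        by (rule Suc.prems(5))
      moreover have "(\<Otimes>l \<in> {..<Suc s}. d l ((j(s := c)) l))
          = d s c \<otimes> (\<Otimes>l \<in> {..<s}. d l ((j(s := c)) l))"
        unfolding lessThan_Suc using dj c Suc.prems(2)
        by (subst finprod_insert) (auto simp: Pi_iff)
      moreover have "(\<Otimes>l \<in> {..<s}. d l ((j(s := c)) l)) = (\<Otimes>l \<in> {..<s}. d l (j l))"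
        using dj by (intro finprod_cong') auto
      ultimately show "?y \<otimes> d s c = \<zero>"
        using Suc.prems(1) Suc.prems(2)[of s c] c dj by (simp add: m_ac)
    qed (use Suc.prems(1) dj in auto)
    then show "(r \<otimes> w s) \<otimes> (\<Otimes>l \<in> {..<s}. d l (j l)) = \<zero>"
      using Suc.prems(1) ws dj by (simp add: m_ac)
  next
    fix l y assume "l < s" "y \<in> carrier R" "\<And>c. c < n \<Longrightarrow> y \<otimes> d l c = \<zero>"
    then show "y \<otimes> w l = \<zero>"
      using Suc.prems(4)[of l y] by simp
  qed (use Suc.prems ws in auto)
  then show ?case
    using Suc.prems(1) ws w by (simp add: lessThan_Suc m_ac)
qed

end


section \<open>Points of products, powers and function spaces\<close>

lemma (in category) HomD:
  assumes "f \<in> Hom E X Y"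
  shows "Dom E f = X" "Cod E f = Y" "X \<in> Obj E" "Y \<in> Obj E" "f \<in> Arr E"
  using assms Dom_in_Obj Cod_in_Obj by (auto simp: Hom_def)

context elementary_topos
begin

lemma bang_in_hom: "U \<in> Obj E \<Longrightarrow> bang E U \<in> Hom E U (One E)"
  unfolding bang_def by (rule theI') (rule terminal)

lemma One_hom_unique: "f \<in> Hom E U (One E) \<Longrightarrow> g \<in> Hom E U (One E) \<Longrightarrow> f = g"
  using terminal(2) HomD by blast

lemma Comp_bang: "h \<in> Hom E W U \<Longrightarrow> Comp E (bang E U) h = bang E W"
  by (rule One_hom_unique[OF Comp_in_hom]) (auto intro: bang_in_hom dest: HomD)

lemma pair_props:
  assumes "f \<in> Hom E U X" "g \<in> Hom E U Y"
  shows "pair E f g \<in> Hom E U (Prod E X Y)" (is ?hom)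
    and "Comp E (Fst E X Y) (pair E f g) = f" (is ?fst)
    and "Comp E (Snd E X Y) (pair E f g) = g" (is ?snd)
proof -
  have "?hom \<and> ?fst \<and> ?snd"
    unfolding pair_def HomD[OF assms(1)] HomD[OF assms(2)]
    using theI'[OF product(4)[OF assms]] by simp
  then show ?hom ?fst ?snd by auto
qed

lemmas pair_in_hom = pair_props(1)

lemma Prod_hom_eqI:
  assumes "p \<in> Hom E U (Prod E X Y)" "q \<in> Hom E U (Prod E X Y)" "X \<in> Obj E" "Y \<in> Obj E"
    and "Comp E (Fst E X Y) p = Comp E (Fst E X Y) q" "Comp E (Snd E X Y) p = Comp E (Snd E X Y) q"
  shows "p = q"
  using product(4)[of "Comp E (Fst E X Y) q" U X "Comp E (Snd E X Y) q" Y]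
    assms Comp_in_hom product(2,3) by blast

lemma Comp_pair:
  assumes f: "f \<in> Hom E U X" and g: "g \<in> Hom E U Y" and h: "h \<in> Hom E W U"
  shows "Comp E (pair E f g) h = pair E (Comp E f h) (Comp E g h)"
proof -
  note XY = HomD(4)[OF f] HomD(4)[OF g]
  note p = pair_props[OF f g]
  note q = pair_props[OF Comp_in_hom[OF h f] Comp_in_hom[OF h g]]
  show ?thesis
    by (rule Prod_hom_eqI[OF Comp_in_hom[OF h p(1)] q(1) XY])
      (simp_all add: q p Comp_assoc[OF h p(1)] Comp_assoc[OF h p(1) product(2)[OF XY]]
         Comp_assoc[OF h p(1) product(3)[OF XY]])
qed

lemma pow_in_Obj: "X \<in> Obj E \<Longrightarrow> pow E X n \<in> Obj E"
  by (induction n) (auto intro: terminal product)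

lemma proj_in_hom: "X \<in> Obj E \<Longrightarrow> i < n \<Longrightarrow> proj E X n i \<in> Hom E (pow E X n) X"
proof (induction n)
  case (Suc n)
  then show ?case
    using product(2,3)[OF pow_in_Obj[of X n], of X] Comp_in_hom by (auto simp: less_Suc_eq)
qed simp

lemma tuple_in_hom:
  assumes "U \<in> Obj E" "\<And>i. i < n \<Longrightarrow> x i \<in> Hom E U X"
  shows "tuple E U n x \<in> Hom E U (pow E X n)"
  using assms by (induction n) (auto intro: bang_in_hom pair_in_hom)

lemma proj_tuple:
  assumes "U \<in> Obj E" "X \<in> Obj E" "\<And>i. i < n \<Longrightarrow> x i \<in> Hom E U X" "i < n"
  shows "Comp E (proj E X n i) (tuple E U n x) = x i"
  using assms
proof (induction n)
  case (Suc n)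
  have t: "tuple E U n x \<in> Hom E U (pow E X n)" and x: "x n \<in> Hom E U X"
    using Suc.prems by (auto intro: tuple_in_hom)
  note P = pow_in_Obj[OF Suc.prems(2), of n]
  note p = pair_props[OF t x]
  show ?case
  proof (cases "i = n")
    case False
    then have i: "i < n" using Suc.prems by simp
    show ?thesis
      using False Suc.IH[OF Suc.prems(1,2) _ i] Suc.prems(3) p
        Comp_assoc[OF p(1) product(2)[OF P Suc.prems(2)] proj_in_hom[OF Suc.prems(2) i]] by simp
  qed (use p in simp)
qed simp

lemma pow_hom_eqI:
  assumes "X \<in> Obj E" "p \<in> Hom E U (pow E X n)" "q \<in> Hom E U (pow E X n)"
    and "\<And>i. i < n \<Longrightarrow> Comp E (proj E X n i) p = Comp E (proj E X n i) q"
  shows "p = q"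
  using assms
proof (induction n arbitrary: p q)
  case 0
  then show ?case using One_hom_unique by simp
next
  case (Suc n)
  note P = pow_in_Obj[OF Suc.prems(1), of n]
  note F = product(2)[OF P Suc.prems(1)]
  have pq: "p \<in> Hom E U (Prod E (pow E X n) X)" "q \<in> Hom E U (Prod E (pow E X n) X)"
    using Suc.prems by auto
  show ?case
  proof (rule Prod_hom_eqI[OF pq P Suc.prems(1)])
    show "Comp E (Fst E (pow E X n) X) p = Comp E (Fst E (pow E X n) X) q"
    proof (rule Suc.IH[OF Suc.prems(1) Comp_in_hom[OF pq(1) F] Comp_in_hom[OF pq(2) F]])
      fix i assume i: "i < n"
      note pr = proj_in_hom[OF Suc.prems(1) i]
      show "Comp E (proj E X n i) (Comp E (Fst E (pow E X n) X) p)
          = Comp E (proj E X n i) (Comp E (Fst E (pow E X n) X) q)"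
        using Suc.prems(4)[of i] i
        by (simp add: Comp_assoc[OF pq(1) F pr] Comp_assoc[OF pq(2) F pr])
    qed
    show "Comp E (Snd E (pow E X n) X) p = Comp E (Snd E (pow E X n) X) q"
      using Suc.prems(4)[of n] by simp
  qed
qed

lemma Comp_tuple:
  assumes "h \<in> Hom E W U" "\<And>i. i < n \<Longrightarrow> x i \<in> Hom E U X"
  shows "Comp E (tuple E U n x) h = tuple E W n (\<lambda>i. Comp E (x i) h)"
  using assms
proof (induction n)
  case 0
  then show ?case by (simp add: Comp_bang)
next
  case (Suc n)
  then show ?case
    using Comp_pair[OF tuple_in_hom[of U n x X] Suc.prems(2)[of n] Suc.prems(1)] HomD(3,4)[OF Suc.prems(1)]
    by simp
qed

lemma tuple_cong: "(\<And>i. i < n \<Longrightarrow> x i = y i) \<Longrightarrow> tuple E U n x = tuple E U n y"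
  by (induction n) auto

lemma app_in_hom:
  assumes "X \<in> Obj E" "Y \<in> Obj E" "f \<in> Hom E U (Exp E X Y)" "x \<in> Hom E U X"
  shows "app E X Y f x \<in> Hom E U Y"
  unfolding app_def using assms by (metis Comp_in_hom pair_in_hom exponential(2))

lemma Comp_app:
  assumes "X \<in> Obj E" "Y \<in> Obj E" "f \<in> Hom E U (Exp E X Y)" "x \<in> Hom E U X" "h \<in> Hom E W U"
  shows "Comp E (app E X Y f x) h = app E X Y (Comp E f h) (Comp E x h)"
  unfolding app_def
  using Comp_assoc[OF assms(5) pair_in_hom[OF assms(3,4)] exponential(2)[OF assms(1,2)]]
    Comp_pair[OF assms(3-5)] by simp

text \<open>
  A term in a variable of \<open>X\<close>, with parameters at stage \<open>U\<close>, is an arrow on \<open>U \<times> X\<close>.  Its transpose is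
  the internal map \<open>x \<mapsto> f(x)\<close>, and the equation says that this map may be evaluated at any
  later stage by substitution.
\<close>

lemma obtain_transpose:
  assumes "U \<in> Obj E" "X \<in> Obj E" "Y \<in> Obj E" and f: "f \<in> Hom E (Prod E U X) Y"
  obtains g where "g \<in> Hom E U (Exp E X Y)"
    and "\<And>W h x. h \<in> Hom E W U \<Longrightarrow> x \<in> Hom E W X \<Longrightarrow>
           app E X Y (Comp E g h) x = Comp E f (pair E h x)"
proof -
  note F = product(2)[OF assms(1,2)] and S = product(3)[OF assms(1,2)]
  obtain g where g: "g \<in> Hom E U (Exp E X Y)"
    and eq: "Comp E (Ev E X Y) (pair E (Comp E g (Fst E U X)) (Snd E U X)) = f"
    using exponential(3)[OF assms] by blast
  have "app E X Y (Comp E g h) x = Comp E f (pair E h x)"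
    if h: "h \<in> Hom E W U" and x: "x \<in> Hom E W X" for W h x
  proof -
    note p = pair_props[OF h x]
    have gF: "Comp E g (Fst E U X) \<in> Hom E (Prod E U X) (Exp E X Y)"
      by (rule Comp_in_hom[OF F g])
    have "Comp E f (pair E h x)
        = Comp E (app E X Y (Comp E g (Fst E U X)) (Snd E U X)) (pair E h x)"
      using eq by (simp add: app_def)
    also have "\<dots> = app E X Y (Comp E (Comp E g (Fst E U X)) (pair E h x)) x"
      using Comp_app[OF assms(2,3) gF S p(1)] p by simp
    also have "Comp E (Comp E g (Fst E U X)) (pair E h x) = Comp E g h"
      using Comp_assoc[OF p(1) F g] p by simp
    finally show ?thesis by simp
  qed
  then show thesis using that g by blast
qed

lemma equalizer_mono:
  assumes "f \<in> Hom E X Y" "g \<in> Hom E X Y"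
  obtains S e where "e \<in> Hom E S X" "is_mono E e"
    and "\<And>U x. x \<in> Hom E U X \<Longrightarrow>
           Comp E f x = Comp E g x \<longleftrightarrow> (\<exists>y \<in> Hom E U S. x = Comp E e y)"
proof -
  obtain S e where S: "e \<in> Hom E S X" and eq: "Comp E f e = Comp E g e"
    and univ: "\<And>U x. U \<in> Obj E \<Longrightarrow> x \<in> Hom E U X \<Longrightarrow> Comp E f x = Comp E g x \<Longrightarrow>
             (\<exists>!y. y \<in> Hom E U S \<and> Comp E e y = x)"
    using equalizer[OF assms] by blast
  have eqy: "Comp E f (Comp E e y) = Comp E g (Comp E e y)" if "y \<in> Hom E U S" for U y
    using Comp_assoc[OF that S assms(1)] Comp_assoc[OF that S assms(2)] eq by simp
  have "is_mono E e"
    unfolding is_mono_def HomD[OF S]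
  proof (intro conjI ballI impI)
    fix U x y assume "U \<in> Obj E" "x \<in> Hom E U S" "y \<in> Hom E U S" "Comp E e x = Comp E e y"
    then show "x = y"
      using univ[of U "Comp E e y"] eqy[of y U] Comp_in_hom[OF _ S, of y U] by blast
  qed (use HomD[OF S] in simp)
  moreover have "Comp E f x = Comp E g x \<longleftrightarrow> (\<exists>y \<in> Hom E U S. x = Comp E e y)"
    if "x \<in> Hom E U X" for U x
    using univ[of U x] eqy that HomD(3)[OF that] by metis
  ultimately show thesis using that S by blast
qed

text \<open>
  A subset cut out by finitely many equations is represented by a subobject: equalize the equations
  one after another and compose the monomorphisms.
\<close>

lemma joint_equalizer:
  assumes "finite J" "X \<in> Obj E" "\<And>j. j \<in> J \<Longrightarrow> f j \<in> Hom E X Y" "\<And>j. j \<in> J \<Longrightarrow> g j \<in> Hom E X Y"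
  shows "\<exists>S e. e \<in> Hom E S X \<and> is_mono E e \<and> (\<forall>U. \<forall>x \<in> Hom E U X.
           (\<forall>j \<in> J. Comp E (f j) x = Comp E (g j) x) \<longleftrightarrow> (\<exists>y \<in> Hom E U S. x = Comp E e y))"
  using assms
proof (induction J rule: finite_induct)
  case empty
  have I: "Id E X \<in> Hom E X X" by (rule Id_in_hom) (rule empty)
  have "is_mono E (Id E X)"
    unfolding is_mono_def HomD[OF I] using HomD[OF I] Comp_Id_left by auto
  then show ?case using I Comp_Id_left by (metis empty_iff)
next
  case (insert j J)
  obtain S e where S: "e \<in> Hom E S X" "is_mono E e"
    and univ: "\<And>U x. x \<in> Hom E U X \<Longrightarrow>
           (\<forall>j \<in> J. Comp E (f j) x = Comp E (g j) x) \<longleftrightarrow> (\<exists>y \<in> Hom E U S. x = Comp E e y)"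
    using insert by auto
  have fg: "f j \<in> Hom E X Y" "g j \<in> Hom E X Y" using insert.prems by auto
  obtain T i where T: "i \<in> Hom E T S" "is_mono E i"
    and univ': "\<And>U y. y \<in> Hom E U S \<Longrightarrow>
        Comp E (Comp E (f j) e) y = Comp E (Comp E (g j) e) y \<longleftrightarrow> (\<exists>z \<in> Hom E U T. y = Comp E i z)"
    using equalizer_mono[OF Comp_in_hom[OF S(1) fg(1)] Comp_in_hom[OF S(1) fg(2)]] by metis
  have ei: "Comp E e i \<in> Hom E T X" by (rule Comp_in_hom[OF T(1) S(1)])
  have "is_mono E (Comp E e i)"
    unfolding is_mono_def HomD[OF ei]
  proof (intro conjI ballI impI)
    fix U x y assume U: "U \<in> Obj E" and x: "x \<in> Hom E U T" and y: "y \<in> Hom E U T"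
      and "Comp E (Comp E e i) x = Comp E (Comp E e i) y"
    then have "Comp E e (Comp E i x) = Comp E e (Comp E i y)"
      using Comp_assoc[OF x T(1) S(1)] Comp_assoc[OF y T(1) S(1)] by simp
    then have "Comp E i x = Comp E i y"
      using S(2) U Comp_in_hom[OF x T(1)] Comp_in_hom[OF y T(1)]
      by (auto simp: is_mono_def HomD[OF S(1)])
    then show "x = y"
      using T(2) U x y by (auto simp: is_mono_def HomD[OF T(1)])
  qed (use HomD[OF ei] in simp)
  moreover have "(\<forall>j' \<in> insert j J. Comp E (f j') x = Comp E (g j') x)
      \<longleftrightarrow> (\<exists>z \<in> Hom E U T. x = Comp E (Comp E e i) z)" if x: "x \<in> Hom E U X" for U x
  proof -
    have *: "Comp E (f j) (Comp E e y) = Comp E (g j) (Comp E e y)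
        \<longleftrightarrow> (\<exists>z \<in> Hom E U T. y = Comp E i z)" if "y \<in> Hom E U S" for y
      using univ'[OF that] Comp_assoc[OF that S(1) fg(1)] Comp_assoc[OF that S(1) fg(2)] by simp
    have e_i: "Comp E e (Comp E i z) = Comp E (Comp E e i) z" "Comp E i z \<in> Hom E U S"
      if "z \<in> Hom E U T" for z
      using Comp_assoc[OF that T(1) S(1)] Comp_in_hom[OF that T(1)] by auto
    show ?thesis
    proof
      assume eq: "\<forall>j' \<in> insert j J. Comp E (f j') x = Comp E (g j') x"
      then obtain y where y: "y \<in> Hom E U S" "x = Comp E e y"
        using univ[OF x] by auto
      then obtain z where "z \<in> Hom E U T" "y = Comp E i z"
        using *[OF y(1)] eq by auto
      then show "\<exists>z \<in> Hom E U T. x = Comp E (Comp E e i) z"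
        using y e_i by auto
    next
      assume "\<exists>z \<in> Hom E U T. x = Comp E (Comp E e i) z"
      then obtain z where z: "z \<in> Hom E U T" "x = Comp E e (Comp E i z)"
        using e_i by auto
      then show "\<forall>j' \<in> insert j J. Comp E (f j') x = Comp E (g j') x"
        using univ[OF x] *[OF e_i(2)[OF z(1)]] e_i(2)[OF z(1)] by auto
    qed
  qed
  ultimately show ?case using ei by blast
qed

end


section \<open>Vectors over the ring object\<close>

context comm_rat_algebra_object
begin

abbreviation R_at :: "'o \<Rightarrow> 'a ring" where
  "R_at U \<equiv> at_stage E R U"

lemma carrier_R_at: "carrier (R_at U) = Hom E U (Space R)"
  by (simp add: at_stage_def)

text \<open>
  Since the ring operations at a stage are composition with fixed arrows, passing to a later stage
  is a ring homomorphism; all naturality statements for sums and products follow from this.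
\<close>

lemma restriction_ring_hom:
  assumes h: "h \<in> Hom E W U"
  shows "ring_hom_cring (R_at U) (R_at W) (\<lambda>a. Comp E a h)"
proof -
  have WU: "W \<in> Obj E" "U \<in> Obj E" using HomD[OF h] by auto
  have op: "Comp E (Comp E m (pair E x y)) h = Comp E m (pair E (Comp E x h) (Comp E y h))"
    if "m \<in> Hom E (Prod E (Space R) (Space R)) (Space R)"
      "x \<in> Hom E U (Space R)" "y \<in> Hom E U (Space R)" for m x y
    using Comp_assoc[OF h pair_in_hom[OF that(2,3)] that(1)] Comp_pair[OF that(2,3) h] by simp
  have "Comp E (Comp E (Unit R) (bang E U)) h = Comp E (Unit R) (bang E W)"
    using Comp_assoc[OF h bang_in_hom[OF WU(2)] Unit_in_hom] Comp_bang[OF h] by simp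
  then have "(\<lambda>a. Comp E a h) \<in> ring_hom (R_at U) (R_at W)"
    using op[OF Mult_in_hom] op[OF Add_in_hom]
    by (intro ring_hom_memI) (auto simp: at_stage_def intro: Comp_in_hom[OF h])
  then show ?thesis
    using cring_at_stage WU by (simp add: ring_hom_cring_def ring_hom_cring_axioms_def)
qed

lemma coord_closed:
  "v \<in> Hom E U (Rpow E R n) \<Longrightarrow> c < n \<Longrightarrow> coord E R n c v \<in> carrier (R_at U)"
  unfolding coord_def carrier_R_at
  using Comp_in_hom proj_in_hom[OF Space_in_Obj] by blast

lemma coord_Comp:
  assumes "v \<in> Hom E U (Rpow E R n)" "c < n" "h \<in> Hom E W U"
  shows "coord E R n c (Comp E v h) = Comp E (coord E R n c v) h"
  unfolding coord_def
  using Comp_assoc[OF assms(3,1) proj_in_hom[OF Space_in_Obj assms(2)]] .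

lemma vector_in_hom:
  "U \<in> Obj E \<Longrightarrow> (\<And>c. c < n \<Longrightarrow> x c \<in> carrier (R_at U)) \<Longrightarrow> tuple E U n x \<in> Hom E U (Rpow E R n)"
  unfolding carrier_R_at by (rule tuple_in_hom)

lemma coord_tuple:
  "U \<in> Obj E \<Longrightarrow> (\<And>c. c < n \<Longrightarrow> x c \<in> carrier (R_at U)) \<Longrightarrow> c < n \<Longrightarrow>
    coord E R n c (tuple E U n x) = x c"
  unfolding carrier_R_at coord_def by (rule proj_tuple[OF _ Space_in_Obj])

lemma vector_eqI:
  "v \<in> Hom E U (Rpow E R n) \<Longrightarrow> w \<in> Hom E U (Rpow E R n) \<Longrightarrow>
    (\<And>c. c < n \<Longrightarrow> coord E R n c v = coord E R n c w) \<Longrightarrow> v = w"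
  unfolding coord_def by (rule pow_hom_eqI[OF Space_in_Obj])

lemma vadd_vdiff:
  assumes v: "v \<in> Hom E U (Rpow E R n)" and w: "w \<in> Hom E U (Rpow E R n)"
  shows vadd_in_hom: "vadd E R n U v w \<in> Hom E U (Rpow E R n)"
    and vdiff_in_hom: "vdiff E R n U v w \<in> Hom E U (Rpow E R n)"
    and coord_vadd: "c < n \<Longrightarrow> coord E R n c (vadd E R n U v w)
          = coord E R n c v \<oplus>\<^bsub>R_at U\<^esub> coord E R n c w"
    and coord_vdiff: "c < n \<Longrightarrow> coord E R n c (vdiff E R n U v w)
          = coord E R n c v \<ominus>\<^bsub>R_at U\<^esub> coord E R n c w"
proof -
  have U: "U \<in> Obj E" using HomD[OF v] by simp
  interpret cring "R_at U" by (rule cring_at_stage[OF U])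
  note cl = coord_closed[OF v] coord_closed[OF w]
  show "vadd E R n U v w \<in> Hom E U (Rpow E R n)" "vdiff E R n U v w \<in> Hom E U (Rpow E R n)"
    unfolding vadd_def vdiff_def using cl by (auto intro!: vector_in_hom[OF U])
  show "coord E R n c (vadd E R n U v w) = coord E R n c v \<oplus>\<^bsub>R_at U\<^esub> coord E R n c w"
    "coord E R n c (vdiff E R n U v w) = coord E R n c v \<ominus>\<^bsub>R_at U\<^esub> coord E R n c w" if "c < n"
    unfolding vadd_def vdiff_def using cl that by (auto simp: coord_tuple[OF U])
qed

lemma vscale:
  assumes v: "v \<in> Hom E U (Rpow E R n)" and r: "r \<in> carrier (R_at U)"
  shows vscale_in_hom: "vscale E R n U r v \<in> Hom E U (Rpow E R n)"
    and coord_vscale: "c < n \<Longrightarrow> coord E R n c (vscale E R n U r v)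
          = r \<otimes>\<^bsub>R_at U\<^esub> coord E R n c v"
proof -
  have U: "U \<in> Obj E" using HomD[OF v] by simp
  interpret cring "R_at U" by (rule cring_at_stage[OF U])
  note cl = coord_closed[OF v] r
  show "vscale E R n U r v \<in> Hom E U (Rpow E R n)"
    unfolding vscale_def using cl by (auto intro!: vector_in_hom[OF U])
  show "coord E R n c (vscale E R n U r v) = r \<otimes>\<^bsub>R_at U\<^esub> coord E R n c v" if "c < n"
    unfolding vscale_def using cl that by (auto simp: coord_tuple[OF U])
qed

lemma Comp_vadd:
  assumes v: "v \<in> Hom E U (Rpow E R n)" and w: "w \<in> Hom E U (Rpow E R n)" and h: "h \<in> Hom E W U"
  shows "Comp E (vadd E R n U v w) h = vadd E R n W (Comp E v h) (Comp E w h)"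
proof -
  interpret ring_hom_cring "R_at U" "R_at W" "\<lambda>a. Comp E a h"
    by (rule restriction_ring_hom[OF h])
  note vw = vadd_in_hom[OF v w]
  note vw' = Comp_in_hom[OF h v] Comp_in_hom[OF h w]
  show ?thesis
    by (rule vector_eqI[OF Comp_in_hom[OF h vw] vadd_in_hom[OF vw']])
      (simp add: coord_Comp[OF vw _ h] coord_vadd[OF v w] coord_vadd[OF vw']
        coord_Comp[OF v _ h] coord_Comp[OF w _ h] coord_closed[OF v] coord_closed[OF w])
qed

lemma Comp_coord_product:
  assumes v: "\<And>l. l \<in> A \<Longrightarrow> v l \<in> Hom E U (Rpow E R n)" and c: "\<And>l. l \<in> A \<Longrightarrow> c l < n"
    and h: "h \<in> Hom E W U"
  shows "Comp E (\<Otimes>\<^bsub>R_at U\<^esub> l \<in> A. coord E R n (c l) (v l)) h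
    = (\<Otimes>\<^bsub>R_at W\<^esub> l \<in> A. coord E R n (c l) (Comp E (v l) h))"
proof -
  interpret ring_hom_cring "R_at U" "R_at W" "\<lambda>a. Comp E a h"
    by (rule restriction_ring_hom[OF h])
  have cl: "(\<lambda>l. coord E R n (c l) (v l)) \<in> A \<rightarrow> carrier (R_at U)"
    using v c coord_closed by auto
  have cl': "(\<lambda>l. coord E R n (c l) (Comp E (v l) h)) \<in> A \<rightarrow> carrier (R_at W)"
    using v c coord_closed Comp_in_hom[OF h] by auto
  show ?thesis
    unfolding hom_finprod[OF cl] using v c
    by (intro S.finprod_cong' cl') (auto simp: coord_Comp[OF _ _ h])
qed

lemma Dk_in_hom: "d \<in> Dk E R k n U \<Longrightarrow> d \<in> Hom E U (Rpow E R n)"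
  by (simp add: Dk_def)

lemma zero_in_Dk:
  assumes U: "U \<in> Obj E"
  shows "tuple E U n (\<lambda>c. \<zero>\<^bsub>R_at U\<^esub>) \<in> Dk E R k n U"
proof -
  interpret cring "R_at U" by (rule cring_at_stage[OF U])
  have "(\<Otimes>\<^bsub>R_at U\<^esub> l \<in> {..<Suc k}. coord E R n (j l) (tuple E U n (\<lambda>c. \<zero>\<^bsub>R_at U\<^esub>))) = \<zero>\<^bsub>R_at U\<^esub>"
    if j: "j \<in> {..<Suc k} \<rightarrow> {..<n}" for j
  proof -
    have "(\<Otimes>\<^bsub>R_at U\<^esub> l \<in> {..<Suc k}. coord E R n (j l) (tuple E U n (\<lambda>c. \<zero>\<^bsub>R_at U\<^esub>)))
        = (\<Otimes>\<^bsub>R_at U\<^esub> l \<in> {..<Suc k}. \<zero>\<^bsub>R_at U\<^esub>)"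
      using j by (intro finprod_cong') (auto simp: coord_tuple[OF U] Pi_iff)
    then show ?thesis by (simp add: lessThan_Suc)
  qed
  then show ?thesis
    by (simp add: Dk_def vector_in_hom[OF U])
qed

text \<open>
  The equations defining \<open>D\<^sub>k(n)\<close> are read at the generic point of \<open>R\<^sup>n\<close>, the identity of \<open>R\<^sup>n\<close>, which
  turns them into equations between arrows; every other point is a restriction of the generic one.
\<close>

lemma Dk_has_extent: "\<exists>D i. is_extent E (Rpow E R n) (Dk E R k n) D i"
proof -
  let ?X = "Rpow E R n"
  \<comment> \<open>Only the values of an index function on \<open>{..<Suc k}\<close> matter; extensional functions make the
      family of equations finite.\<close>
  let ?J = "{..<Suc k} \<rightarrow>\<^sub>E {..<n}"
  have X: "?X \<in> Obj E" by (rule pow_in_Obj[OF Space_in_Obj])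
  interpret cring "R_at ?X" by (rule cring_at_stage[OF X])
  let ?f = "\<lambda>j. \<Otimes>\<^bsub>R_at ?X\<^esub> l \<in> {..<Suc k}. coord E R n (j l) (Id E ?X)"
  have f: "?f j \<in> Hom E ?X (Space R)" if "j \<in> ?J" for j
    using that coord_closed[OF Id_in_hom[OF X]] unfolding carrier_R_at[symmetric]
    by (intro finprod_closed) (auto simp: PiE_iff)
  have g: "\<zero>\<^bsub>R_at ?X\<^esub> \<in> Hom E ?X (Space R)"
    unfolding carrier_R_at[symmetric] by simp
  obtain D i where i: "i \<in> Hom E D ?X" "is_mono E i"
    and univ: "\<And>U x. x \<in> Hom E U ?X \<Longrightarrow>
        (\<forall>j \<in> ?J. Comp E (?f j) x = Comp E \<zero>\<^bsub>R_at ?X\<^esub> x) \<longleftrightarrow> (\<exists>d \<in> Hom E U D. x = Comp E i d)"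
    using joint_equalizer[where J = ?J and f = ?f and g = "\<lambda>_. \<zero>\<^bsub>R_at ?X\<^esub>", OF _ X f g]
    by (auto simp: finite_PiE)
  have "x \<in> Dk E R k n U \<longleftrightarrow> (\<exists>d \<in> Hom E U D. x = Comp E i d)" if x: "x \<in> Hom E U ?X" for U x
  proof -
    interpret h: ring_hom_cring "R_at ?X" "R_at U" "\<lambda>a. Comp E a x"
      by (rule restriction_ring_hom[OF x])
    let ?p = "\<lambda>j. \<Otimes>\<^bsub>R_at U\<^esub> l \<in> {..<Suc k}. coord E R n (j l) x"
    have "Comp E (?f j) x = ?p j" if "j \<in> ?J" for j
      using Comp_coord_product[of "{..<Suc k}" "\<lambda>_. Id E ?X" ?X n j x U] that x
        Id_in_hom[OF X] Comp_Id_left[OF x] by (auto simp: PiE_iff)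
    then have "(\<exists>d \<in> Hom E U D. x = Comp E i d) \<longleftrightarrow> (\<forall>j \<in> ?J. ?p j = \<zero>\<^bsub>R_at U\<^esub>)"
      using univ[OF x] by simp
    also have "\<dots> \<longleftrightarrow> (\<forall>j \<in> {..<Suc k} \<rightarrow> {..<n}. ?p j = \<zero>\<^bsub>R_at U\<^esub>)"
    proof
      assume *: "\<forall>j \<in> ?J. ?p j = \<zero>\<^bsub>R_at U\<^esub>"
      show "\<forall>j \<in> {..<Suc k} \<rightarrow> {..<n}. ?p j = \<zero>\<^bsub>R_at U\<^esub>"
      proof
        fix j assume j: "j \<in> {..<Suc k} \<rightarrow> {..<n}"
        have "?p j = ?p (restrict j {..<Suc k})"
          using j coord_closed[OF x] by (intro h.S.finprod_cong') (auto simp: Pi_iff)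
        also have "\<dots> = \<zero>\<^bsub>R_at U\<^esub>"
        proof (rule bspec[OF *])
          show "restrict j {..<Suc k} \<in> ?J" using j by (auto simp: restrict_PiE_iff)
        qed
        finally show "?p j = \<zero>\<^bsub>R_at U\<^esub>" .
      qed
    qed (auto simp: PiE_def)
    finally show ?thesis using x by (simp add: Dk_def)
  qed
  then show ?thesis
    unfolding is_extent_def using i by blast
qed


section \<open>Maps and infinitesimal differences\<close>

text \<open>
  The only use of the Kock--Lawvere axiom.  It is applied to \<open>x \<mapsto> f(Q + x)\<^sub>c\<close> on \<open>D\<^sub>k(n)\<close>, whose values
  at \<open>P - Q\<close> and at \<open>0\<close> are \<open>f(P)\<^sub>c\<close> and \<open>f(Q)\<^sub>c\<close>.  If \<open>y\<close> annihilates the coordinates of \<open>P - Q\<close>, the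
  arguments \<open>P - Q\<close> and \<open>0\<close> are congruent modulo the annihilator of \<open>y\<close>, and so are the
  values of any polynomial at them.
\<close>

lemma map_difference_annihilated:
  assumes kl: "kock_lawvere E R" and kn: "k \<ge> 1" "n \<ge> 1"
    and f: "f \<in> Hom E W (Exp E (Rpow E R n) (Rpow E R m))"
    and P: "P \<in> Hom E W (Rpow E R n)" and Q: "Q \<in> Hom E W (Rpow E R n)"
    and d: "vdiff E R n W P Q \<in> Dk E R k n W"
    and y: "y \<in> carrier (R_at W)"
    and yd: "\<And>c. c < n \<Longrightarrow> y \<otimes>\<^bsub>R_at W\<^esub> coord E R n c (vdiff E R n W P Q) = \<zero>\<^bsub>R_at W\<^esub>"
    and c: "c < m"
  shows "y \<otimes>\<^bsub>R_at W\<^esub> coord E R m c (vdiff E R m W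
           (app E (Rpow E R n) (Rpow E R m) f P) (app E (Rpow E R n) (Rpow E R m) f Q)) = \<zero>\<^bsub>R_at W\<^esub>"
proof -
  let ?X = "Rpow E R n" and ?Y = "Rpow E R m"
  have W: "W \<in> Obj E" using HomD[OF f] by simp
  have XY: "?X \<in> Obj E" "?Y \<in> Obj E" by (rule pow_in_Obj[OF Space_in_Obj])+
  interpret cring "R_at W" by (rule cring_at_stage[OF W])
  note Id = Id_in_hom[OF W]
  obtain D i where ext: "is_extent E ?X (Dk E R k n) D i"
    using Dk_has_extent by blast
  then have i: "i \<in> Hom E D ?X" by (simp add: is_extent_def)
  then have D: "D \<in> Obj E" by (rule HomD)
  let ?S = "Prod E W D"
  note F = product(2)[OF W D] and S = product(3)[OF W D]
  \<comment> \<open>At stage \<open>W \<times> D\<close> the second projection is a generic element of \<open>D\<^sub>k(n)\<close>; the data given at stage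
      \<open>W\<close> are pulled back along the first.\<close>
  let ?Q = "Comp E Q (Fst E W D)" and ?i = "Comp E i (Snd E W D)" and ?f = "Comp E f (Fst E W D)"
  have Q': "?Q \<in> Hom E ?S ?X" and i': "?i \<in> Hom E ?S ?X" and f': "?f \<in> Hom E ?S (Exp E ?X ?Y)"
    using Comp_in_hom F S Q i f by blast+
  note Qi = vadd_in_hom[OF Q' i']
  let ?g = "coord E R m c (app E ?X ?Y ?f (vadd E R n ?S ?Q ?i))"
  have "?g \<in> Hom E ?S (Space R)"
    using coord_closed[OF app_in_hom[OF XY f' Qi] c] by (simp add: carrier_R_at)
  then obtain t where t: "t \<in> Hom E W (Exp E D (Space R))"
    and t_app: "\<And>V h x. h \<in> Hom E V W \<Longrightarrow> x \<in> Hom E V D \<Longrightarrow>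
           app E D (Space R) (Comp E t h) x = Comp E ?g (pair E h x)"
    using obtain_transpose[OF W D Space_in_Obj] by metis
  obtain a where a: "a \<in> multi_indices n k \<rightarrow>\<^sub>E Hom E W (Space R)"
    and a_eval: "\<And>V h d. V \<in> Obj E \<Longrightarrow> h \<in> Hom E V W \<Longrightarrow> d \<in> Hom E V D \<Longrightarrow>
         app E D (Space R) (Comp E t h) d =
           poly_eval (R_at V) n k (\<lambda>\<alpha>. Comp E (a \<alpha>) h) (\<lambda>c. coord E R n c (Comp E i d))"
    using kl[unfolded kock_lawvere_def] kn ext W t by meson
  let ?a = "\<lambda>\<alpha>. Comp E (a \<alpha>) (Id E W)"
  have a': "?a \<in> multi_indices n k \<rightarrow> carrier (R_at W)"
    using a Comp_in_hom[OF Id] by (auto simp: carrier_R_at PiE_iff)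
  have taylor: "coord E R m c (app E ?X ?Y f (vadd E R n W Q e))
      = poly_eval (R_at W) n k ?a (\<lambda>c. coord E R n c e)" if e: "e \<in> Dk E R k n W" for e
  proof -
    obtain x where x: "x \<in> Hom E W D" and ix: "Comp E i x = e"
      using ext e W Dk_in_hom[OF e] unfolding is_extent_def by metis
    let ?p = "pair E (Id E W) x"
    note p = pair_props[OF Id x]
    have comp: "Comp E ?Q ?p = Q" "Comp E ?f ?p = f" "Comp E ?i ?p = e"
      using Comp_assoc[OF p(1) F Q] Comp_assoc[OF p(1) F f] Comp_assoc[OF p(1) S i] p ix
        Comp_Id_right[OF Q] Comp_Id_right[OF f] by simp_all
    have "Comp E ?g ?p = coord E R m c (app E ?X ?Y f (vadd E R n W Q e))"
      using coord_Comp[OF app_in_hom[OF XY f' Qi] c p(1)] Comp_app[OF XY f' Qi p(1)]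
        Comp_vadd[OF Q' i' p(1)] comp by simp
    then show ?thesis
      using t_app[OF Id x] a_eval[OF W Id x] ix by simp
  qed
  let ?d = "vdiff E R n W P Q" and ?o = "tuple E W n (\<lambda>c. \<zero>\<^bsub>R_at W\<^esub>)"
  note dh = Dk_in_hom[OF d] and zero = zero_in_Dk[OF W, of n k]
  note oh = Dk_in_hom[OF zero]
  note cl = coord_closed[OF P] coord_closed[OF Q]
  have Pd: "vadd E R n W Q ?d = P"
  proof (rule vector_eqI[OF vadd_in_hom[OF Q dh] P])
    fix c assume "c < n"
    then show "coord E R n c (vadd E R n W Q ?d) = coord E R n c P"
      using cl by (simp add: coord_vadd[OF Q dh] coord_vdiff[OF P Q]
        minus_eq a_lcomm[of "coord E R n c Q"] r_neg)
  qed
  have Qo: "vadd E R n W Q ?o = Q"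
    by (rule vector_eqI[OF vadd_in_hom[OF Q oh] Q])
      (use cl in \<open>simp add: coord_vadd[OF Q oh] coord_tuple[OF W]\<close>)
  have cong: "y \<otimes>\<^bsub>R_at W\<^esub> poly_eval (R_at W) n k ?a (\<lambda>c. coord E R n c ?d)
      = y \<otimes>\<^bsub>R_at W\<^esub> poly_eval (R_at W) n k ?a (\<lambda>c. coord E R n c ?o)"
    using coord_closed[OF dh] coord_closed[OF oh] y yd
    by (intro mult_poly_eval_cong a') (auto simp: coord_tuple[OF W])
  note fP = app_in_hom[OF XY f P] and fQ = app_in_hom[OF XY f Q]
  have "y \<otimes>\<^bsub>R_at W\<^esub> coord E R m c (app E ?X ?Y f P) = y \<otimes>\<^bsub>R_at W\<^esub> coord E R m c (app E ?X ?Y f Q)"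
    using cong taylor[OF d] taylor[OF zero] by (simp add: Pd Qo)
  then show ?thesis
    using y coord_closed[OF fP c] coord_closed[OF fQ c]
    by (simp add: coord_vdiff[OF fP fQ c] minus_eq r_distr r_minus r_neg)
qed


section \<open>Multilinear maps and products of coordinates\<close>

lemma app_tuple_closed:
  assumes "\<phi> \<in> Hom E U (Exp E (pow E (Rpow E R n) q) (Space R))"
    and "v \<in> {..<q} \<rightarrow> Hom E U (Rpow E R n)"
  shows "app_tuple E R n q U \<phi> v \<in> carrier (R_at U)"
  unfolding app_tuple_def carrier_R_at
  using assms HomD(3)[OF assms(1)]
  by (intro app_in_hom tuple_in_hom pow_in_Obj Space_in_Obj) auto

text \<open>
  The internal map \<open>(v\<^sub>0, v\<^sub>1, \<dots>) \<mapsto> \<Prod>\<^sub>l (v\<^sub>l)\<^sub>c\<^sub>(\<^sub>l\<^sub>)\<close>, the test map that extracts information from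
  membership in \<open>DN\<^sub>k\<close>.
\<close>

lemma coord_product_multilinear:
  assumes U: "U \<in> Obj E" and c: "c \<in> {..<q} \<rightarrow> {..<n}"
  obtains \<phi> where "multilinear E R n q U \<phi>"
    and "\<And>W h v. h \<in> Hom E W U \<Longrightarrow> v \<in> {..<q} \<rightarrow> Hom E W (Rpow E R n) \<Longrightarrow>
      app_tuple E R n q W (Comp E \<phi> h) v = (\<Otimes>\<^bsub>R_at W\<^esub> l \<in> {..<q}. coord E R n (c l) (v l))"
proof -
  let ?X = "Rpow E R n"
  let ?Y = "pow E ?X q"
  have X: "?X \<in> Obj E" by (rule pow_in_Obj[OF Space_in_Obj])
  then have Y: "?Y \<in> Obj E" by (rule pow_in_Obj)
  note S = product(3)[OF U Y]
  let ?S = "Prod E U ?Y"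
  let ?v = "\<lambda>l. Comp E (proj E ?X q l) (Snd E U ?Y)"
  have v: "?v l \<in> Hom E ?S ?X" if "l < q" for l
    using Comp_in_hom[OF S proj_in_hom[OF X that]] .
  define g where "g = (\<Otimes>\<^bsub>R_at ?S\<^esub> l \<in> {..<q}. coord E R n (c l) (?v l))"
  interpret S: cring "R_at ?S" by (rule cring_at_stage[OF product(1)[OF U Y]])
  have g: "g \<in> Hom E ?S (Space R)"
    unfolding carrier_R_at[symmetric] g_def using c v by (intro S.finprod_closed) (auto intro!: coord_closed)
  obtain \<phi> where \<phi>: "\<phi> \<in> Hom E U (Exp E ?Y (Space R))"
    and \<phi>_app: "\<And>W h x. h \<in> Hom E W U \<Longrightarrow> x \<in> Hom E W ?Y \<Longrightarrow>
           app E ?Y (Space R) (Comp E \<phi> h) x = Comp E g (pair E h x)"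
    using obtain_transpose[OF U Y Space_in_Obj g] by metis
  have eval: "app_tuple E R n q W (Comp E \<phi> h) w = (\<Otimes>\<^bsub>R_at W\<^esub> l \<in> {..<q}. coord E R n (c l) (w l))"
    if h: "h \<in> Hom E W U" and w: "w \<in> {..<q} \<rightarrow> Hom E W ?X" for W h w
  proof -
    have W: "W \<in> Obj E" using HomD[OF h] by simp
    interpret W: cring "R_at W" by (rule cring_at_stage[OF W])
    have w': "w l \<in> Hom E W ?X" if "l < q" for l using w that by auto
    have t: "tuple E W q w \<in> Hom E W ?Y"
      using w' by (intro tuple_in_hom[OF W])
    note p = pair_props[OF h t]
    have vw: "Comp E (?v l) (pair E h (tuple E W q w)) = w l" if "l < q" for l
      using Comp_assoc[OF p(1) S proj_in_hom[OF X that]] p proj_tuple[OF W X w' that] by simp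
    have "app_tuple E R n q W (Comp E \<phi> h) w = Comp E g (pair E h (tuple E W q w))"
      unfolding app_tuple_def using \<phi>_app[OF h t] .
    also have "\<dots> = (\<Otimes>\<^bsub>R_at W\<^esub> l \<in> {..<q}. coord E R n (c l) (Comp E (?v l) (pair E h (tuple E W q w))))"
      unfolding g_def using c v by (intro Comp_coord_product[OF _ _ p(1)]) auto
    also have "\<dots> = (\<Otimes>\<^bsub>R_at W\<^esub> l \<in> {..<q}. coord E R n (c l) (w l))"
      using c w' by (intro W.finprod_cong') (auto simp: vw intro!: coord_closed)
    finally show ?thesis .
  qed
  moreover have "multilinear E R n q U \<phi>"
    unfolding multilinear_def
  proof (intro conjI ballI allI impI)
    fix W h v l assume W: "W \<in> Obj E" and h: "h \<in> Hom E W U" and v: "v \<in> {..<q} \<rightarrow> Hom E W ?X" and l: "l < q"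
    interpret W: cring "R_at W" by (rule cring_at_stage[OF W])
    let ?rest = "\<Otimes>\<^bsub>R_at W\<^esub> l' \<in> {..<q} - {l}. coord E R n (c l') (v l')"
    have rest: "(\<lambda>l'. coord E R n (c l') (v l')) \<in> {..<q} - {l} \<rightarrow> carrier (R_at W)"
      using c v by (auto intro!: coord_closed)
    have cl: "c l < n" using c l by auto
    have slot: "app_tuple E R n q W (Comp E \<phi> h) (v(l := x)) = coord E R n (c l) x \<otimes>\<^bsub>R_at W\<^esub> ?rest"
      if x: "x \<in> Hom E W ?X" for x
    proof -
      have "app_tuple E R n q W (Comp E \<phi> h) (v(l := x))
          = (\<Otimes>\<^bsub>R_at W\<^esub> l' \<in> insert l ({..<q} - {l}). coord E R n (c l') ((v(l := x)) l'))"
        using v x l by (subst eval[OF h]) (auto simp: insert_absorb)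
      also have "\<dots> = coord E R n (c l) x \<otimes>\<^bsub>R_at W\<^esub>
          (\<Otimes>\<^bsub>R_at W\<^esub> l' \<in> {..<q} - {l}. coord E R n (c l') ((v(l := x)) l'))"
        using rest coord_closed[OF x cl] by (subst W.finprod_insert) (auto simp: Pi_iff)
      also have "(\<Otimes>\<^bsub>R_at W\<^esub> l' \<in> {..<q} - {l}. coord E R n (c l') ((v(l := x)) l')) = ?rest"
        using rest by (intro W.finprod_cong') auto
      finally show ?thesis .
    qed
    note rc = W.finprod_closed[OF rest]
    show "app_tuple E R n q W (Comp E \<phi> h) (v(l := vadd E R n W x y))
        = app_tuple E R n q W (Comp E \<phi> h) (v(l := x)) \<oplus>\<^bsub>R_at W\<^esub>
          app_tuple E R n q W (Comp E \<phi> h) (v(l := y))"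
      if x: "x \<in> Hom E W ?X" and y: "y \<in> Hom E W ?X" for x y
      using rc coord_closed[OF x cl] coord_closed[OF y cl]
      by (simp add: slot x y vadd_in_hom[OF x y] coord_vadd[OF x y cl] W.l_distr)
    show "app_tuple E R n q W (Comp E \<phi> h) (v(l := vscale E R n W r x))
        = r \<otimes>\<^bsub>R_at W\<^esub> app_tuple E R n q W (Comp E \<phi> h) (v(l := x))"
      if "r \<in> Hom E W (Space R)" and x: "x \<in> Hom E W ?X" for r x
    proof -
      have r: "r \<in> carrier (R_at W)" using that by (simp add: carrier_R_at)
      show ?thesis
        using rc coord_closed[OF x cl] r
        by (simp add: slot x vscale_in_hom[OF x r] coord_vscale[OF x r cl] W.m_assoc)
    qed
  qed (rule \<phi>)
  ultimately show thesis using that by blast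
qed

lemma DN_cong:
  assumes "\<And>l. l < Suc k \<Longrightarrow> v l = w l"
  shows "v \<in> DN E R k n U \<longleftrightarrow> w \<in> DN E R k n U"
proof -
  have "app_tuple E R n (Suc k) W \<phi> (\<lambda>l. Comp E (v l) h)
      = app_tuple E R n (Suc k) W \<phi> (\<lambda>l. Comp E (w l) h)" for W h \<phi>
    unfolding app_tuple_def
    by (intro arg_cong[where f = "app E _ _ \<phi>"] tuple_cong) (simp add: assms)
  then show ?thesis by (simp add: DN_def assms)
qed

lemma DN_coord_product_eq_zero:
  assumes U: "U \<in> Obj E" and v: "v \<in> DN E R k n U" and c: "c \<in> {..<Suc k} \<rightarrow> {..<n}"
  shows "(\<Otimes>\<^bsub>R_at U\<^esub> l \<in> {..<Suc k}. coord E R n (c l) (v l)) = \<zero>\<^bsub>R_at U\<^esub>"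
proof -
  note Id = Id_in_hom[OF U]
  have vh: "v l \<in> Hom E U (Rpow E R n)" if "l < Suc k" for l
    using v that unfolding DN_def by (blast intro: Dk_in_hom)
  obtain \<phi> where \<phi>: "multilinear E R n (Suc k) U \<phi>"
    and eval: "\<And>W h v. h \<in> Hom E W U \<Longrightarrow> v \<in> {..<Suc k} \<rightarrow> Hom E W (Rpow E R n) \<Longrightarrow>
      app_tuple E R n (Suc k) W (Comp E \<phi> h) v = (\<Otimes>\<^bsub>R_at W\<^esub> l \<in> {..<Suc k}. coord E R n (c l) (v l))"
    using coord_product_multilinear[OF U c] by blast
  have "Comp E \<phi> (Id E U) = \<phi>"
    using \<phi> Comp_Id_right by (auto simp: multilinear_def)
  then have "(\<Otimes>\<^bsub>R_at U\<^esub> l \<in> {..<Suc k}. coord E R n (c l) (v l)) = app_tuple E R n (Suc k) U \<phi> v"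
    using eval[OF Id, of v] vh by simp
  also have "\<dots> = app_tuple E R n (Suc k) U \<phi> (\<lambda>l. Comp E (v l) (Id E U))"
    unfolding app_tuple_def using Comp_Id_right[OF vh]
    by (intro arg_cong[where f = "app E _ _ \<phi>"] tuple_cong) simp
  also have "\<dots> = \<zero>\<^bsub>R_at U\<^esub>"
  proof -
    have "\<forall>W \<in> Obj E. \<forall>h \<in> Hom E W U. \<forall>\<phi>. multilinear E R n (Suc k) W \<phi> \<longrightarrow>
        app_tuple E R n (Suc k) W \<phi> (\<lambda>l. Comp E (v l) h) = \<zero>\<^bsub>R_at W\<^esub>"
      using v by (simp add: DN_def)
    from this[rule_format, OF U Id \<phi>] show ?thesis .
  qed
  finally show ?thesis .
qed

text \<open>
  Linearity in one argument gives \<open>\<phi>(\<dots>, x, \<dots>) = \<Sum>\<^sub>c x\<^sub>c \<phi>(\<dots>, e\<^sub>c, \<dots>)\<close>.  As every summand is killed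
  by \<open>r\<close>, it is enough to build \<open>x\<close> up coordinate by coordinate, without forming the sum.
\<close>

lemma linear_slot_eq_zero:
  assumes \<phi>: "multilinear E R n q U \<phi>" and v: "v \<in> {..<q} \<rightarrow> Hom E U (Rpow E R n)" and l: "l < q"
    and r: "r \<in> carrier (R_at U)" and x: "x \<in> Hom E U (Rpow E R n)"
    and basis: "\<And>c. c < n \<Longrightarrow> (r \<otimes>\<^bsub>R_at U\<^esub> coord E R n c x) \<otimes>\<^bsub>R_at U\<^esub> app_tuple E R n q U \<phi>
        (v(l := tuple E U n (\<lambda>c'. if c' = c then \<one>\<^bsub>R_at U\<^esub> else \<zero>\<^bsub>R_at U\<^esub>))) = \<zero>\<^bsub>R_at U\<^esub>"
  shows "r \<otimes>\<^bsub>R_at U\<^esub> app_tuple E R n q U \<phi> (v(l := x)) = \<zero>\<^bsub>R_at U\<^esub>"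
proof -
  let ?X = "Rpow E R n"
  have U: "U \<in> Obj E" using HomD[OF x] by simp
  interpret cring "R_at U" by (rule cring_at_stage[OF U])
  have \<phi>h: "\<phi> \<in> Hom E U (Exp E (pow E ?X q) (Space R))" using \<phi> by (simp add: multilinear_def)
  define F where "F z = app_tuple E R n q U \<phi> (v(l := z))" for z
  have F_closed: "F z \<in> carrier (R_at U)" if "z \<in> Hom E U ?X" for z
    unfolding F_def using v that by (intro app_tuple_closed[OF \<phi>h]) auto
  have add: "F (vadd E R n U y z) = F y \<oplus>\<^bsub>R_at U\<^esub> F z" if "y \<in> Hom E U ?X" "z \<in> Hom E U ?X" for y z
    using \<phi>[unfolded multilinear_def] U Id_in_hom[OF U] v l that Comp_Id_right[OF \<phi>h]
    unfolding F_def by metis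
  have scale: "F (vscale E R n U s z) = s \<otimes>\<^bsub>R_at U\<^esub> F z" if "s \<in> carrier (R_at U)" "z \<in> Hom E U ?X" for s z
    using \<phi>[unfolded multilinear_def] U Id_in_hom[OF U] v l that Comp_Id_right[OF \<phi>h]
    unfolding F_def carrier_R_at by metis
  let ?e = "\<lambda>c. tuple E U n (\<lambda>c'. if c' = c then \<one>\<^bsub>R_at U\<^esub> else \<zero>\<^bsub>R_at U\<^esub>)"
  \<comment> \<open>\<open>head N\<close> agrees with \<open>x\<close> in the first \<open>N\<close> coordinates and is zero elsewhere.\<close>
  define head where "head N = tuple E U n (\<lambda>c. if c < N then coord E R n c x else \<zero>\<^bsub>R_at U\<^esub>)" for N
  have e: "?e c \<in> Hom E U ?X" for c by (intro vector_in_hom[OF U]) auto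
  have xN: "head N \<in> Hom E U ?X" for N
    unfolding head_def by (intro vector_in_hom[OF U]) (auto intro: coord_closed[OF x])
  have cx: "coord E R n c (head N) = (if c < N then coord E R n c x else \<zero>\<^bsub>R_at U\<^esub>)" if "c < n" for c N
    unfolding head_def by (rule coord_tuple[OF U]) (use that in \<open>auto intro: coord_closed[OF x]\<close>)
  have ce: "coord E R n c (?e c') = (if c = c' then \<one>\<^bsub>R_at U\<^esub> else \<zero>\<^bsub>R_at U\<^esub>)" if "c < n" for c c'
    by (rule coord_tuple[OF U]) (use that in auto)
  have "N \<le> n \<Longrightarrow> r \<otimes>\<^bsub>R_at U\<^esub> F (head N) = \<zero>\<^bsub>R_at U\<^esub>" for N
  proof (induction N)
    case 0
    have "vscale E R n U \<zero>\<^bsub>R_at U\<^esub> (head 0) = head 0"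
      by (rule vector_eqI[OF vscale_in_hom[OF xN zero_closed] xN])
        (simp add: coord_vscale[OF xN zero_closed] cx)
    then show ?case
      using scale[OF zero_closed xN, of 0] F_closed[OF xN, of 0] r by simp
  next
    case (Suc N)
    then have N: "N < n" by simp
    note xc = coord_closed[OF x N]
    note s = vscale_in_hom[OF e xc]
    have "head (Suc N) = vadd E R n U (head N) (vscale E R n U (coord E R n N x) (?e N))"
      by (rule vector_eqI[OF xN vadd_in_hom[OF xN s]])
        (use xc coord_closed[OF x] in \<open>auto simp: coord_vadd[OF xN s]
          coord_vscale[OF e xc] cx ce less_Suc_eq\<close>)
    then have "F (head (Suc N)) = F (head N) \<oplus>\<^bsub>R_at U\<^esub> coord E R n N x \<otimes>\<^bsub>R_at U\<^esub> F (?e N)"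
      using add[OF xN s] scale[OF xc e] by simp
    then show ?case
      using Suc.IH N basis[OF N, folded F_def] r xc F_closed[OF xN] F_closed[OF e] by (simp add: r_distr m_assoc)
  qed
  moreover have "head n = x"
    by (rule vector_eqI[OF xN x]) (simp add: cx)
  ultimately show ?thesis unfolding F_def by (metis order_refl)
qed

text \<open>
  The induction replaces the arguments of \<open>\<phi>\<close> by basis vectors, starting with the last of the first \<open>s\<close>,
  and collects the coordinates that split off in the multiplier \<open>r\<close>.  The hypothesis for \<open>s\<close> only
  involves the arguments that are still untouched, and for \<open>s = 0\<close> it says \<open>r = 0\<close>.
\<close>

lemma multilinear_eq_zero:
  assumes \<phi>: "multilinear E R n q U \<phi>" and "v \<in> {..<q} \<rightarrow> Hom E U (Rpow E R n)"
    and "s \<le> q" and "r \<in> carrier (R_at U)"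
    and "\<And>c. c \<in> {..<s} \<rightarrow> {..<n} \<Longrightarrow>
      r \<otimes>\<^bsub>R_at U\<^esub> (\<Otimes>\<^bsub>R_at U\<^esub> l \<in> {..<s}. coord E R n (c l) (v l)) = \<zero>\<^bsub>R_at U\<^esub>"
  shows "r \<otimes>\<^bsub>R_at U\<^esub> app_tuple E R n q U \<phi> v = \<zero>\<^bsub>R_at U\<^esub>"
  using assms(2-)
proof (induction s arbitrary: r v)
  have \<phi>h: "\<phi> \<in> Hom E U (Exp E (pow E (Rpow E R n) q) (Space R))"
    using \<phi> by (simp add: multilinear_def)
  then have U: "U \<in> Obj E" by (rule HomD)
  interpret cring "R_at U" by (rule cring_at_stage[OF U])
  {
    case 0
    then have "r = \<zero>\<^bsub>R_at U\<^esub>" by simp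
    then show ?case using app_tuple_closed[OF \<phi>h] 0 by simp
  next
    case (Suc s)
    then have s: "s < q" by simp
    have vs: "v s \<in> Hom E U (Rpow E R n)" using Suc.prems s by auto
    let ?e = "\<lambda>c. tuple E U n (\<lambda>c'. if c' = c then \<one>\<^bsub>R_at U\<^esub> else \<zero>\<^bsub>R_at U\<^esub>)"
    have e: "?e c \<in> Hom E U (Rpow E R n)" for c by (intro vector_in_hom[OF U]) auto
    have "r \<otimes>\<^bsub>R_at U\<^esub> app_tuple E R n q U \<phi> (v(s := v s)) = \<zero>\<^bsub>R_at U\<^esub>"
    proof (rule linear_slot_eq_zero[OF \<phi> Suc.prems(1) s Suc.prems(3) vs])
      fix c assume c: "c < n"
      note vc = coord_closed[OF vs c]
      show "(r \<otimes>\<^bsub>R_at U\<^esub> coord E R n c (v s)) \<otimes>\<^bsub>R_at U\<^esub> app_tuple E R n q U \<phi> (v(s := ?e c)) = \<zero>\<^bsub>R_at U\<^esub>"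
      proof (rule Suc.IH)
        fix b assume b: "b \<in> {..<s} \<rightarrow> {..<n}"
        have vb: "(\<lambda>l. coord E R n (b l) (v l)) \<in> {..<s} \<rightarrow> carrier (R_at U)"
          using b Suc.prems(1) s by (auto intro!: coord_closed)
        let ?b = "b(s := c)"
        have same: "(\<Otimes>\<^bsub>R_at U\<^esub> l \<in> {..<s}. coord E R n (?b l) (v l))
              = (\<Otimes>\<^bsub>R_at U\<^esub> l \<in> {..<s}. coord E R n (b l) (v l))"
            "(\<Otimes>\<^bsub>R_at U\<^esub> l \<in> {..<s}. coord E R n (b l) ((v(s := ?e c)) l))
              = (\<Otimes>\<^bsub>R_at U\<^esub> l \<in> {..<s}. coord E R n (b l) (v l))"
          using vb by (intro finprod_cong'; auto)+
        have "?b \<in> {..<Suc s} \<rightarrow> {..<n}"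
          using b c by (auto simp: less_Suc_eq Pi_iff)
        then have "r \<otimes>\<^bsub>R_at U\<^esub> (\<Otimes>\<^bsub>R_at U\<^esub> l \<in> {..<Suc s}. coord E R n (?b l) (v l)) = \<zero>\<^bsub>R_at U\<^esub>"
          by (rule Suc.prems(4))
        moreover have "(\<Otimes>\<^bsub>R_at U\<^esub> l \<in> {..<Suc s}. coord E R n (?b l) (v l))
            = coord E R n c (v s) \<otimes>\<^bsub>R_at U\<^esub> (\<Otimes>\<^bsub>R_at U\<^esub> l \<in> {..<s}. coord E R n (?b l) (v l))"
          unfolding lessThan_Suc using vb vc by (subst finprod_insert) (auto simp: Pi_iff)
        ultimately show "(r \<otimes>\<^bsub>R_at U\<^esub> coord E R n c (v s)) \<otimes>\<^bsub>R_at U\<^esub>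
            (\<Otimes>\<^bsub>R_at U\<^esub> l \<in> {..<s}. coord E R n (b l) ((v(s := ?e c)) l)) = \<zero>\<^bsub>R_at U\<^esub>"
          using Suc.prems(3) vc vb unfolding same by (simp add: m_assoc)
      qed (use Suc.prems s e vc in auto)
    qed
    then show ?case by simp
  }
qed

lemma coord_products_eq_zero_imp_DN:
  assumes U: "U \<in> Obj E" and Dk: "\<And>l. l < Suc k \<Longrightarrow> v l \<in> Dk E R k n U"
    and prod: "\<And>c. c \<in> {..<Suc k} \<rightarrow> {..<n} \<Longrightarrow>
      (\<Otimes>\<^bsub>R_at U\<^esub> l \<in> {..<Suc k}. coord E R n (c l) (v l)) = \<zero>\<^bsub>R_at U\<^esub>"
  shows "v \<in> DN E R k n U"
  unfolding DN_def
proof (intro CollectI conjI allI impI ballI)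
  fix W h \<phi> assume W: "W \<in> Obj E" and h: "h \<in> Hom E W U" and \<phi>: "multilinear E R n (Suc k) W \<phi>"
  interpret ring_hom_cring "R_at U" "R_at W" "\<lambda>a. Comp E a h"
    by (rule restriction_ring_hom[OF h])
  have v: "v l \<in> Hom E U (Rpow E R n)" if "l < Suc k" for l
    using Dk[OF that] by (rule Dk_in_hom)
  let ?v = "\<lambda>l. Comp E (v l) h"
  have vh: "?v \<in> {..<Suc k} \<rightarrow> Hom E W (Rpow E R n)"
    using v Comp_in_hom[OF h] by auto
  have zero: "(\<Otimes>\<^bsub>R_at W\<^esub> l \<in> {..<Suc k}. coord E R n (c l) (?v l)) = \<zero>\<^bsub>R_at W\<^esub>"
    if c: "c \<in> {..<Suc k} \<rightarrow> {..<n}" for c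
  proof -
    have "(\<Otimes>\<^bsub>R_at W\<^esub> l \<in> {..<Suc k}. coord E R n (c l) (?v l))
        = Comp E (\<Otimes>\<^bsub>R_at U\<^esub> l \<in> {..<Suc k}. coord E R n (c l) (v l)) h"
      using c v by (intro Comp_coord_product[symmetric, OF _ _ h]) auto
    then show ?thesis by (simp add: prod[OF c])
  qed
  have "\<one>\<^bsub>R_at W\<^esub> \<otimes>\<^bsub>R_at W\<^esub> app_tuple E R n (Suc k) W \<phi> ?v = \<zero>\<^bsub>R_at W\<^esub>"
    by (rule multilinear_eq_zero[OF \<phi> vh order_refl]) (auto simp: zero)
  moreover have "app_tuple E R n (Suc k) W \<phi> ?v \<in> carrier (R_at W)"
    using \<phi> vh by (intro app_tuple_closed) (auto simp: multilinear_def)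
  ultimately show "app_tuple E R n (Suc k) W \<phi> ?v = \<zero>\<^bsub>R_at W\<^esub>"
    by simp
qed (rule Dk)


section \<open>Maps preserve the \<open>k\<close>th-order i-structure\<close>

lemma map_preserves_DN:
  assumes kl: "kock_lawvere E R" and kn: "k \<ge> 1" "n \<ge> 1"
    and f: "f \<in> Hom E W (Exp E (Rpow E R n) (Rpow E R m))"
    and P: "\<And>l. l < Suc k \<Longrightarrow> P l \<in> Hom E W (Rpow E R n)"
    and Q: "\<And>l. l < Suc k \<Longrightarrow> Q l \<in> Hom E W (Rpow E R n)"
    and DN: "(\<lambda>l. vdiff E R n W (P l) (Q l)) \<in> DN E R k n W"
  shows "(\<lambda>l. vdiff E R m W (app E (Rpow E R n) (Rpow E R m) f (P l))
            (app E (Rpow E R n) (Rpow E R m) f (Q l))) \<in> DN E R k m W"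
proof -
  let ?d = "\<lambda>l. vdiff E R n W (P l) (Q l)"
  let ?w = "\<lambda>l. vdiff E R m W (app E (Rpow E R n) (Rpow E R m) f (P l))
            (app E (Rpow E R n) (Rpow E R m) f (Q l))"
  have W: "W \<in> Obj E" using HomD[OF f] by simp
  have XY: "Rpow E R n \<in> Obj E" "Rpow E R m \<in> Obj E" by (rule pow_in_Obj[OF Space_in_Obj])+
  interpret cring "R_at W" by (rule cring_at_stage[OF W])
  have d: "?d l \<in> Dk E R k n W" if "l < Suc k" for l
    using DN that by (simp add: DN_def)
  have w: "?w l \<in> Hom E W (Rpow E R m)" if "l < Suc k" for l
    using vdiff_in_hom[OF app_in_hom[OF XY f P] app_in_hom[OF XY f Q]] that by simp
  \<comment> \<open>The reindexing \<open>g\<close> covers both conditions in \<open>DN\<^sub>k\<close>: a constant \<open>g\<close> gives \<open>w\<^sub>l \<in> D\<^sub>k(m)\<close>, the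
      identity gives the products of coordinates of different vectors.\<close>
  have products: "(\<Otimes>\<^bsub>R_at W\<^esub> l \<in> {..<Suc k}. coord E R m (c l) (?w (g l))) = \<zero>\<^bsub>R_at W\<^esub>"
    if c: "c \<in> {..<Suc k} \<rightarrow> {..<m}" and g: "\<And>l. l < Suc k \<Longrightarrow> g l < Suc k"
      and zero: "\<And>j. j \<in> {..<Suc k} \<rightarrow> {..<n} \<Longrightarrow>
        (\<Otimes>\<^bsub>R_at W\<^esub> l \<in> {..<Suc k}. coord E R n (j l) (?d (g l))) = \<zero>\<^bsub>R_at W\<^esub>" for c g
  proof -
    have cl: "(\<lambda>l. coord E R m (c l) (?w (g l))) \<in> {..<Suc k} \<rightarrow> carrier (R_at W)"
      using c g by (auto intro!: coord_closed w)
    have "\<one>\<^bsub>R_at W\<^esub> \<otimes>\<^bsub>R_at W\<^esub> (\<Otimes>\<^bsub>R_at W\<^esub> l \<in> {..<Suc k}. coord E R m (c l) (?w (g l))) = \<zero>\<^bsub>R_at W\<^esub>"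
    proof (rule mult_finprod_eq_zero[where d = "\<lambda>l b. coord E R n b (?d (g l))" and n = n])
      fix l y assume l: "l < Suc k" and y: "y \<in> carrier (R_at W)"
        and "\<And>b. b < n \<Longrightarrow> y \<otimes>\<^bsub>R_at W\<^esub> coord E R n b (?d (g l)) = \<zero>\<^bsub>R_at W\<^esub>"
      then show "y \<otimes>\<^bsub>R_at W\<^esub> coord E R m (c l) (?w (g l)) = \<zero>\<^bsub>R_at W\<^esub>"
        using c g[OF l]
        by (intro map_difference_annihilated[OF kl kn f P Q d]) auto
    next
      fix l b assume "l < Suc k" "b < n"
      then show "coord E R n b (?d (g l)) \<in> carrier (R_at W)"
        using d[OF g] by (intro coord_closed Dk_in_hom)
    qed (use cl zero in auto)
    then show ?thesis using cl by simp
  qed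
  show ?thesis
  proof (rule coord_products_eq_zero_imp_DN[OF W])
    show "?w l \<in> Dk E R k m W" if l: "l < Suc k" for l
      using products[of _ "\<lambda>_. l"] d[OF l] w[OF l] l by (simp add: Dk_def)
    show "(\<Otimes>\<^bsub>R_at W\<^esub> l \<in> {..<Suc k}. coord E R m (c l) (?w l)) = \<zero>\<^bsub>R_at W\<^esub>"
      if "c \<in> {..<Suc k} \<rightarrow> {..<m}" for c
      using products[OF that, of "\<lambda>l. l"] DN_coord_product_eq_zero[OF W DN] by simp
  qed
qed

end

theorem theorem1:
  fixes E :: "('o, 'a) topos_data" and R :: "('o, 'a) ring_data" and k n m :: nat
  assumes "comm_rat_algebra_object E R"
    and "kock_lawvere E R"
    and "k \<ge> 1" and "n \<ge> 1" and "m \<ge> 1"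
    and "U \<in> Obj E" and "f \<in> Hom E U (Exp E (Rpow E R n) (Rpow E R m))"
  shows "i_morphism E (Rpow E R n) (kth_order E R k n) (Rpow E R m) (kth_order E R k m) U f"
proof -
  interpret comm_rat_algebra_object E R by fact
  let ?X = "Rpow E R n" and ?Y = "Rpow E R m"
  have XY: "?X \<in> Obj E" "?Y \<in> Obj E" by (rule pow_in_Obj[OF Space_in_Obj])+
  show ?thesis
    unfolding i_morphism_def
  proof (intro conjI allI ballI)
    fix p W h P assume h: "h \<in> Hom E W U" and P: "P \<in> kth_order E R k n p W"
    let ?f = "Comp E f h"
    have f: "?f \<in> Hom E W (Exp E ?X ?Y)" using Comp_in_hom[OF h] assms by blast
    have Ph: "P l \<in> Hom E W ?X" if "l < p" for l
      using P that by (auto simp: kth_order_def)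
    let ?P = "\<lambda>l \<in> {..<p}. app E ?X ?Y ?f (P l)"
    have "(\<lambda>l. vdiff E R m W (?P (i l)) (?P (j l))) \<in> DN E R k m W"
      if p: "p \<ge> 2" and i: "i \<in> {..<Suc k} \<rightarrow> {..<p}" and j: "j \<in> {..<Suc k} \<rightarrow> {..<p}"
        and ij: "\<forall>l < Suc k. i l \<noteq> j l" for i j
    proof -
      have "(\<lambda>l. vdiff E R n W (P (i l)) (P (j l))) \<in> DN E R k n W"
        using P p i j ij by (simp add: kth_order_def)
      then have D: "(\<lambda>l. vdiff E R m W (app E ?X ?Y ?f (P (i l))) (app E ?X ?Y ?f (P (j l)))) \<in> DN E R k m W"
        using i j by (intro map_preserves_DN[OF assms(2-4) f] Ph) auto
      have "vdiff E R m W (?P (i l)) (?P (j l))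
          = vdiff E R m W (app E ?X ?Y ?f (P (i l))) (app E ?X ?Y ?f (P (j l)))" if "l < Suc k" for l
      proof -
        have "i l < p" "j l < p" using i j that by auto
        then show ?thesis by simp
      qed
      then show ?thesis using D
        by (subst DN_cong) auto
    qed
    then show "?P \<in> kth_order E R k m p W"
      using app_in_hom[OF XY f Ph] by (simp add: kth_order_def)
  qed (rule assms)
qed

end
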